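(* Let $T$ be a tree with $ex(T)\ge 1$. Then $\kappa(T)=\min\{\kappa(T_v): v\in M^*(T)\}$ and, for every real number $k\in[1,\kappa(T)]$, $$\dim_f^k(T)=k|M_2(T)|+\sum_{v\in M_3(T)}\dim_f^k(T_v).$$
   Context: All graphs are finite, simple, undirected and connected. For a connected graph $G$ with at least two vertices, $d(x,y)$ is the length of a shortest path between $x$ and $y$. For distinct $x,y\in V(G)$, let $R\{x,y\}=\{z\in V(G): d(x,z)\neq d(y,z)\}$, and let $\kappa(G)=\min\{|R\{x,y\}|: x\neq y,\ x,y\in V(G)\}$. For a function $g$ on $V(G)$ and $U\subseteq V(G)$, write $g(U)=\sum_{s\in U}g(s)$. For a real number $k\in[1,\kappa(G)]$, a function $g:V(G)\to[0,1]$ is a $k$-resolving function of $G$ if $g(R\{x,y\})\ge k$ for any two distinct vertices $x,y\in V(G)$; the fractional $k$-metric dimension of $G$ is $\dim_f^k(G)=\min\{g(V(G)): g \text{ is a } k\text{-resolving function of } G\}$. A leaf is a vertex of degree one; a major vertex is a vertex of degree at least three. A leaf $u$ is a terminal vertex of a major vertex $v$ if $d(u,v)<d(u,w)$ for every other major vertex $w$. The terminal degree $ter_T(v)$ of a major vertex $v$ of $T$ is the number of terminal vertices of $v$. A major vertex with positive terminal degree is an exterior major vertex; $ex(T)$ is the number of exterior major vertices of $T$. Let $M(T)$ be the set of exterior major vertices of $T$, and let $M_2(T)=\{w\in M(T): ter_T(w)=2\}$ and $M_3(T)=\{w\in M(T): ter_T(w)\ge 3\}$. Let $M^*(T)$ be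 the union $M_2(T)\cup M_3(T)$, i.e. the set of exterior major vertices of terminal degree at least two. For $v\in M(T)$, $T_v$ is the subtree of $T$ induced by $v$ and all vertices belonging to the paths joining $v$ with its terminal vertices; $\kappa(T_v)$ and $\dim_f^k(T_v)$ are computed in the graph $T_v$ itself. *)

theory Defs
  imports "HOL-Analysis.Analysis" "Graph_Theory.Digraph_Component"
begin

text \<open>
  The locale predicate \<open>graph\<close> of the session Graph_Theory describes finite simple undirected
  graphs: each edge is a pair of opposite arcs, and there are no loops and no multiple arcs.  In
  this representation an edge traversed back and forth is a closed walk of length two satisfying
  \<open>pre_digraph.cycle\<close>, so that \<open>forest\<close> and \<open>tree\<close> from that session hold of no
  graph with an edge.  The cycles of the undirected graph are those of length at least three.
\<close>

definition undirected_tree :: "('a, 'b) pre_digraph \<Rightarrow> bool" where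
  "undirected_tree G \<longleftrightarrow> graph G \<and> Digraph_Component.connected G \<and>
     \<not> (\<exists>p. pre_digraph.cycle G p \<and> 3 \<le> length p)"

definition graph_dist :: "('a, 'b) pre_digraph \<Rightarrow> 'a \<Rightarrow> 'a \<Rightarrow> nat" where
  "graph_dist G x y = (LEAST n. \<exists>p. pre_digraph.apath G x p y \<and> length p = n)"


section \<open>Fractional \<open>k\<close>-metric dimension\<close>

definition resolving_set :: "('a, 'b) pre_digraph \<Rightarrow> 'a \<Rightarrow> 'a \<Rightarrow> 'a set" where
  "resolving_set G x y = {z \<in> verts G. graph_dist G x z \<noteq> graph_dist G y z}"

definition metric_kappa :: "('a, 'b) pre_digraph \<Rightarrow> nat" where
  "metric_kappa G =
     Min {card (resolving_set G x y) | x y. x \<in> verts G \<and> y \<in> verts G \<and> x \<noteq> y}"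

definition k_resolving_function :: "('a, 'b) pre_digraph \<Rightarrow> real \<Rightarrow> ('a \<Rightarrow> real) \<Rightarrow> bool" where
  "k_resolving_function G k g \<longleftrightarrow>
     (\<forall>v \<in> verts G. 0 \<le> g v \<and> g v \<le> 1) \<and>
     (\<forall>x \<in> verts G. \<forall>y \<in> verts G. x \<noteq> y \<longrightarrow> k \<le> (\<Sum>z \<in> resolving_set G x y. g z))"

text \<open>
  \<open>LEAST\<close> denotes the minimum of the set of attained values, not merely its infimum.  The
  definition is meaningful only for \<open>1 \<le> k \<le> metric_kappa G\<close>.
\<close>

definition frac_metric_dim :: "real \<Rightarrow> ('a, 'b) pre_digraph \<Rightarrow> real" where
  "frac_metric_dim k G =
     (LEAST s. \<exists>g. k_resolving_function G k g \<and> s = (\<Sum>v \<in> verts G. g v))"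


section \<open>Exterior major vertices\<close>

text \<open>In a graph each edge at \<open>v\<close> contributes exactly one outgoing arc, so that the degree
  of \<open>v\<close> is its out-degree.\<close>

definition is_leaf :: "('a, 'b) pre_digraph \<Rightarrow> 'a \<Rightarrow> bool" where
  "is_leaf G u \<longleftrightarrow> u \<in> verts G \<and> out_degree G u = 1"

definition is_major :: "('a, 'b) pre_digraph \<Rightarrow> 'a \<Rightarrow> bool" where
  "is_major G v \<longleftrightarrow> v \<in> verts G \<and> 3 \<le> out_degree G v"

definition terminal_vertices :: "('a, 'b) pre_digraph \<Rightarrow> 'a \<Rightarrow> 'a set" where
  "terminal_vertices G v =
     {u. is_leaf G u \<and> (\<forall>w. is_major G w \<and> w \<noteq> v \<longrightarrow> graph_dist G u v < graph_dist G u w)}"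

definition terminal_degree :: "('a, 'b) pre_digraph \<Rightarrow> 'a \<Rightarrow> nat" where
  "terminal_degree G v = card (terminal_vertices G v)"

definition exterior_major :: "('a, 'b) pre_digraph \<Rightarrow> 'a set" where
  "exterior_major G = {v. is_major G v \<and> 0 < terminal_degree G v}"

definition exterior_major_count :: "('a, 'b) pre_digraph \<Rightarrow> nat" where
  "exterior_major_count G = card (exterior_major G)"

definition exterior_major2 :: "('a, 'b) pre_digraph \<Rightarrow> 'a set" where
  "exterior_major2 G = {w \<in> exterior_major G. terminal_degree G w = 2}"

definition exterior_major3 :: "('a, 'b) pre_digraph \<Rightarrow> 'a set" where
  "exterior_major3 G = {w \<in> exterior_major G. 3 \<le> terminal_degree G w}"

definition exterior_major_star :: "('a, 'b) pre_digraph \<Rightarrow> 'a set" where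
  "exterior_major_star G = exterior_major2 G \<union> exterior_major3 G"

definition branch_subtree :: "('a, 'b) pre_digraph \<Rightarrow> 'a \<Rightarrow> ('a, 'b) pre_digraph" where
  "branch_subtree G v = G \<restriction>
     insert v {x. \<exists>u p. u \<in> terminal_vertices G v \<and> pre_digraph.apath G v p u \<and>
                    x \<in> set (pre_digraph.awalk_verts G v p)}"

end

theory Submission
  imports Defs
begin

text \<open>
  Two vertices at odd distance are resolved by every vertex.  If the distance is even and \<open>m\<close> is the
  midpoint, they are resolved exactly by the two components of \<open>T - m\<close> that contain them.  A
  component of \<open>T - m\<close> that contains a major vertex contains two legs of some vertex \<open>v\<close> of
  \<open>M\<^sup>*\<close>, namely of a major vertex farthest from \<open>m\<close>; if neither component contains a
  major vertex, both are legs of \<open>m\<close>, for otherwise \<open>T\<close> would be a path.  So every resolving set contains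
  two legs at a common vertex of \<open>M\<^sup>*\<close>, and each such pair of legs is a resolving set.  The
  constraints on a resolving function therefore reduce to \<open>g(L) + g(L') \<ge> k\<close> for legs
  \<open>L \<noteq> L'\<close> at a common \<open>v\<close>.  As legs are disjoint, the linear program splits over
  \<open>M\<^sup>*\<close>, and for terminal degree at least three each part is the program of \<open>T\<^sub>v\<close>.
\<close>

section \<open>Trees as metric spaces\<close>

text \<open>The obstacle is a midpoint inside a leg of \<open>v\<close>. It has degree two, so the
  resolving set taken in \<open>T\<^sub>v\<close> is all of \<open>T\<^sub>v\<close> except that one
  vertex. By size this is harmless: \<open>v\<close> lies in no leg, so at least as many vertices
  remain as in any two legs, and kappa(\<open>T\<^sub>v\<close>) is the least sum of two leg sizes
  for every \<open>v\<close> in \<open>M\<^sup>*\<close>. As a constraint it is harmless only if two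
  legs avoid the missing vertex, that is, from terminal degree three on. With two legs,
  \<open>T\<^sub>v\<close> is a path and its dimension can exceed \<open>k\<close> (on four vertices
  with \<open>k = 3\<close> it is 4), whereas in \<open>T\<close> the same resolving set contains
  two legs of another vertex. Hence the summand for \<open>M\<^sub>2\<close> is \<open>k\<close> and
  not the dimension of \<open>T\<^sub>v\<close>. The programs of \<open>T\<close> and
  \<open>T\<^sub>v\<close> are compared through a closed formula in the number and sizes of the
  legs, so that no resolving function is carried from one graph to the other. Acyclicity enters only
  through \<open>parent_unique\<close>; the arguments about branches and legs use distances
  alone.\<close>

lemma obtain_two:
  assumes "2 \<le> card A"
  obtains x y where "x \<in> A" "y \<in> A" "x \<noteq> y"
proof -
  obtain B where "B \<subseteq> A" "card B = 2" using obtain_subset_with_card_n assms by metis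
  then show thesis using that by (auto simp: card_2_iff)
qed

text \<open>\<open>parent_unique\<close> admits neighbours at the same distance as \<open>y\<close>
  on purpose: strictly nearer neighbours alone would exclude even cycles but not odd ones.\<close>

locale metric_tree =
  fixes V :: "'a set" and d :: "'a \<Rightarrow> 'a \<Rightarrow> nat"
  assumes finite_V: "finite V"
    and dist_zero: "x \<in> V \<Longrightarrow> y \<in> V \<Longrightarrow> d x y = 0 \<longleftrightarrow> x = y"
    and dist_sym: "x \<in> V \<Longrightarrow> y \<in> V \<Longrightarrow> d x y = d y x"
    and triangle: "x \<in> V \<Longrightarrow> y \<in> V \<Longrightarrow> z \<in> V \<Longrightarrow> d x z \<le> d x y + d y z"
    and parent_exists: "r \<in> V \<Longrightarrow> y \<in> V \<Longrightarrow> r \<noteq> y \<Longrightarrow> \<exists>p\<in>V. d y p = 1 \<and> d r y = Suc (d r p)"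
    and parent_unique: "\<lbrakk>r \<in> V; y \<in> V; p \<in> V; q \<in> V; d y p = 1; d y q = 1;
      d r p \<le> d r y; d r q \<le> d r y\<rbrakk> \<Longrightarrow> p = q"
begin

definition nbrs :: "'a \<Rightarrow> 'a set" where
  "nbrs y = {p \<in> V. d y p = 1}"

text \<open>For a neighbour \<open>a\<close> of \<open>m\<close>, this is the component containing
  \<open>a\<close> after \<open>m\<close> is deleted. Comparing distances avoids any talk of
  connectivity.\<close>

definition branch :: "'a \<Rightarrow> 'a \<Rightarrow> 'a set" where
  "branch m a = {z \<in> V. d a z < d m z}"

definition resolving :: "'a \<Rightarrow> 'a \<Rightarrow> 'a set" where
  "resolving x y = {z \<in> V. d x z \<noteq> d y z}"

text \<open>The root \<open>v\<close> is left out so that distinct legs at \<open>v\<close> are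
  disjoint.\<close>

definition leg :: "'a \<Rightarrow> 'a \<Rightarrow> 'a set" where
  "leg v u = {x \<in> V. x \<noteq> v \<and> d v x + d x u = d v u}"

definition major :: "'a \<Rightarrow> bool" where
  "major v \<longleftrightarrow> v \<in> V \<and> 3 \<le> card (nbrs v)"

definition terminals :: "'a \<Rightarrow> 'a set" where
  "terminals v = {u \<in> V. card (nbrs u) = 1 \<and> (\<forall>w. major w \<and> w \<noteq> v \<longrightarrow> d u v < d u w)}"

definition star_majors :: "'a set" where
  "star_majors = {v. major v \<and> 2 \<le> card (terminals v)}"

section \<open>Branches at a vertex\<close>

lemma dist_self [simp]: "x \<in> V \<Longrightarrow> d x x = 0"
  using dist_zero by blast

lemma nbrsD: "p \<in> nbrs y \<Longrightarrow> p \<in> V \<and> d y p = 1"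
  by (simp add: nbrs_def)

lemma nbrs_sym: "y \<in> V \<Longrightarrow> p \<in> nbrs y \<Longrightarrow> y \<in> nbrs p"
  using dist_sym by (auto simp: nbrs_def)

lemma finite_nbrs [simp]: "finite (nbrs y)"
  using finite_V by (simp add: nbrs_def)

lemma majorD: "major v \<Longrightarrow> v \<in> V"
  by (simp add: major_def)

lemma branch_subset: "branch m a \<subseteq> V"
  by (auto simp: branch_def)

text \<open>If \<open>m\<close> and \<open>a\<close> were equidistant from \<open>z\<close>, then
  \<open>a\<close> and the parent of \<open>m\<close> towards \<open>z\<close> would both be
  neighbours of \<open>m\<close> no farther from \<open>z\<close> than \<open>m\<close>. By
  \<open>parent_unique\<close> they would coincide, although the parent is strictly nearer.\<close>

lemma dist_nbr_cases:
  assumes "m \<in> V" "a \<in> nbrs m" "z \<in> V"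
  shows "d m z = Suc (d a z) \<or> d a z = Suc (d m z)"
proof (cases "z = m")
  case True
  then show ?thesis using assms dist_sym[of a m] by (auto simp: nbrs_def)
next
  case False
  have a: "a \<in> V" "d m a = 1" "d a m = 1"
    using assms dist_sym[of a m] by (auto simp: nbrs_def)
  have "d m z \<le> 1 + d a z" "d a z \<le> 1 + d m z"
    using triangle[of m a z] triangle[of a m z] a assms by auto
  moreover have "d m z \<noteq> d a z"
  proof
    assume eq: "d m z = d a z"
    obtain p where p: "p \<in> V" "d m p = 1" "d z m = Suc (d z p)"
      using parent_exists[of z m] assms False by auto
    have s: "d z m = d m z" "d z a = d a z" using dist_sym assms a by auto
    have "p = a"
      by (rule parent_unique[of z m]) (use p a assms eq s in auto)
    then show False using p eq s by simp
  qed
  ultimately show ?thesis by linarith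
qed

lemma mem_branch_iff:
  assumes "m \<in> V" "a \<in> nbrs m" "z \<in> V"
  shows "z \<in> branch m a \<longleftrightarrow> d m z = Suc (d a z)"
  using dist_nbr_cases[OF assms] assms by (auto simp: branch_def)

lemma not_mem_branch_iff:
  assumes "m \<in> V" "a \<in> nbrs m" "z \<in> V"
  shows "z \<notin> branch m a \<longleftrightarrow> d a z = Suc (d m z)"
  using dist_nbr_cases[OF assms] assms by (auto simp: branch_def)

text \<open>Bipartiteness in metric form: moving \<open>y\<close> one step towards \<open>x\<close>
  changes both \<open>d y z\<close> and \<open>d x y\<close> by one, which preserves the parity of
  the sum.\<close>

lemma even_perimeter:
  assumes "x \<in> V" "y \<in> V" "z \<in> V"
  shows "even (d x z + d y z + d x y)"
  using assms
proof (induction "d x y" arbitrary: y)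
  case 0
  then show ?case using dist_zero by auto
next
  case (Suc n)
  then obtain p where p: "p \<in> V" "d y p = 1" "d x y = Suc (d x p)"
    using parent_exists[of x y] dist_zero[of x y] by fastforce
  have IH: "even (d x z + d p z + d x p)" using Suc p by auto
  have "d y z = Suc (d p z) \<or> d p z = Suc (d y z)"
    using p dist_nbr_cases[of y p z] Suc.prems by (auto simp: nbrs_def)
  then show ?case using p(3) IH by (elim disjE) simp_all
qed

lemma root_not_mem_branch: "m \<in> V \<Longrightarrow> m \<notin> branch m a"
  by (simp add: branch_def)

lemma nbr_mem_branch: "a \<in> nbrs m \<Longrightarrow> a \<in> branch m a"
  by (simp add: branch_def nbrs_def)

lemma branch_unique:
  assumes "m \<in> V" "a \<in> nbrs m" "b \<in> nbrs m" "z \<in> branch m a" "z \<in> branch m b"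
  shows "a = b"
  using assms parent_unique[of z m a b] dist_sym[of z m] dist_sym[of z a] dist_sym[of z b]
  by (auto simp: branch_def nbrs_def)

lemma branch_exists:
  assumes "m \<in> V" "z \<in> V" "z \<noteq> m"
  shows "\<exists>a \<in> nbrs m. z \<in> branch m a"
  using parent_exists[of z m] assms dist_sym by (fastforce simp: nbrs_def branch_def)

text \<open>The distances to \<open>m\<close> and to \<open>a\<close> both change by one along the
  edge, which forces \<open>p\<close> to be nearer to \<open>m\<close> and farther from
  \<open>a\<close> than \<open>z\<close>. If \<open>z \<noteq> a\<close>, the parent of
  \<open>z\<close> towards \<open>a\<close> would also be no farther from \<open>m\<close> than
  \<open>z\<close>, hence equal to \<open>p\<close>, a contradiction.\<close>

lemma branch_boundary:
  assumes m: "m \<in> V" and a: "a \<in> nbrs m" and z: "z \<in> branch m a"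
    and p: "p \<in> nbrs z" "p \<notin> branch m a"
  shows "z = a \<and> p = m"
proof -
  have V: "z \<in> V" "p \<in> V" "a \<in> V" using a z p by (auto simp: nbrs_def branch_def)
  have dz: "d m z = Suc (d a z)" using mem_branch_iff m a z V by blast
  have dp: "d a p = Suc (d m p)" using not_mem_branch_iff m a p V by blast
  have c1: "d z m = Suc (d p m) \<or> d p m = Suc (d z m)" using dist_nbr_cases[of z p m] V p m by auto
  have c2: "d z a = Suc (d p a) \<or> d p a = Suc (d z a)" using dist_nbr_cases[of z p a] V p m by auto
  have s: "d z m = d m z" "d p m = d m p" "d z a = d a z" "d p a = d a p" using dist_sym V m by auto
  have e: "d m z = Suc (d m p)" "d a p = Suc (d a z)" using c1 c2 s dz dp by arith+
  have "z = a"
  proof (rule ccontr)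
    assume "z \<noteq> a"
    then obtain q where q: "q \<in> V" "d z q = 1" "d a z = Suc (d a q)"
      using parent_exists[of a z] V by auto
    have "d m q \<le> d m a + d a q" using triangle V m q by blast
    then have "d m q \<le> d m z" using q dz a by (simp add: nbrs_def)
    then have "q = p" using parent_unique[of m z q p] V m q p e by (auto simp: nbrs_def)
    then show False using q e by simp
  qed
  moreover have "p = m" using e dz \<open>z = a\<close> V m dist_zero[of m p] by simp
  ultimately show ?thesis by blast
qed

text \<open>Induction along a shortest path from \<open>z\<close> to \<open>w\<close>: each step
  stays in the branch until it crosses the single edge that leaves it, the one from \<open>a\<close>
  to \<open>m\<close>.\<close>

lemma dist_through_root:
  assumes m: "m \<in> V" and a: "a \<in> nbrs m" and z: "z \<in> branch m a"
    and w: "w \<in> V" "w \<notin> branch m a"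
  shows "d z w = d z m + d m w"
  using z
proof (induction "d w z" arbitrary: z)
  case 0
  then show ?case using w dist_zero[of w z] branch_subset by auto
next
  case (Suc n)
  have zV: "z \<in> V" using Suc.prems by (simp add: branch_def)
  obtain p where p: "p \<in> V" "d z p = 1" "d w z = Suc (d w p)"
    using parent_exists[of w z] zV w Suc dist_zero[of w z] by auto
  have pn: "p \<in> nbrs z" using p by (simp add: nbrs_def)
  show ?case
  proof (cases "p \<in> branch m a")
    case True
    have "d p w = d p m + d m w" using Suc p True by auto
    moreover have "d z m \<le> d z p + d p m" using triangle zV p m by blast
    moreover have "d z w \<le> d z m + d m w" using triangle zV w m by blast
    ultimately show ?thesis using p dist_sym[of w z] dist_sym[of w p] zV w by auto
  next
    case False
    then have "z = a" "p = m" using branch_boundary[OF m a] Suc pn by auto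
    then show ?thesis using p dist_sym zV w m by auto
  qed
qed

text \<open>Outside both branches the two distances pass through \<open>m\<close> and agree. Inside
  the branch of \<open>x\<close>, a path from \<open>y\<close> has to pass through \<open>m\<close>,
  whereas \<open>x\<close> can turn at \<open>a\<close>, which saves at least two.\<close>

lemma resolving_even:
  assumes m: "m \<in> V" and ab: "a \<in> nbrs m" "b \<in> nbrs m" "a \<noteq> b"
    and x: "x \<in> branch m a" and y: "y \<in> branch m b" and eq: "d m x = d m y"
  shows "resolving x y = branch m a \<union> branch m b"
proof -
  have V: "x \<in> V" "y \<in> V" "a \<in> V" "b \<in> V" using x y ab by (auto simp: branch_def nbrs_def)
  have near: "d x z < d y z" if "a \<in> nbrs m" "b \<in> nbrs m" "a \<noteq> b" "x \<in> branch m a"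
    "y \<in> branch m b" "d m x = d m y" "z \<in> branch m a" for a b x y z
  proof -
    have V: "x \<in> V" "y \<in> V" "a \<in> V" "z \<in> V" using that by (auto simp: branch_def nbrs_def)
    have "z \<notin> branch m b" using branch_unique m that by blast
    then have "d y z = d y m + d m z" using dist_through_root m that V by blast
    moreover have "d x z \<le> d x a + d a z" using triangle V by blast
    moreover have "d m z = Suc (d a z)" "d m x = Suc (d a x)" using mem_branch_iff m that V by auto
    ultimately show ?thesis using that(6) dist_sym V m by auto
  qed
  have "d x z = d y z" if "z \<in> V" "z \<notin> branch m a" "z \<notin> branch m b" for z
  proof -
    have "d x z = d x m + d m z" "d y z = d y m + d m z"
      using dist_through_root m ab x y that by blast+
    then show ?thesis using eq dist_sym[of x m] dist_sym[of y m] V m by simp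
  qed
  moreover have "d x z \<noteq> d y z" if "z \<in> branch m a" for z
    using near[OF ab x y eq that] by simp
  moreover have "d x z \<noteq> d y z" if "z \<in> branch m b" for z
    using near[OF ab(2,1) ab(3)[symmetric] y x eq[symmetric] that] by simp
  ultimately show ?thesis
    using branch_subset[of m a] branch_subset[of m b] by (auto simp: resolving_def)
qed

lemma resolving_odd:
  assumes "x \<in> V" "y \<in> V" "odd (d x y)"
  shows "resolving x y = V"
proof -
  have "d x z \<noteq> d y z" if "z \<in> V" for z
    using even_perimeter[of x y z] assms that by auto
  then show ?thesis by (auto simp: resolving_def)
qed

section \<open>Midpoints\<close>

lemma point_between:
  assumes "x \<in> V" "y \<in> V" "h \<le> d x y"
  shows "\<exists>m\<in>V. d x m = h \<and> d m y = d x y - h"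
  using assms
proof (induction "d x y - h" arbitrary: h)
  case 0
  then show ?case by auto
next
  case (Suc n)
  have n: "n = d x y - Suc h" "Suc h \<le> d x y" using Suc.hyps(2) by auto
  obtain m where m: "m \<in> V" "d x m = Suc h" "d m y = d x y - Suc h"
    using Suc.hyps(1)[OF n(1)] Suc.prems n(2) by blast
  then have "x \<noteq> m" using Suc by auto
  then obtain p where p: "p \<in> V" "d m p = 1" "d x m = Suc (d x p)"
    using parent_exists[of x m] m Suc by auto
  have "d x y \<le> d x p + d p y" "d p y \<le> d p m + d m y"
    using triangle p Suc m by blast+
  moreover have "d p m = 1" using dist_sym[of m p] p m by simp
  moreover have "d x p = h" using p m by simp
  ultimately have "d p y = d x y - h" using m n by arith
  then show ?case using p m by auto
qed

text \<open>The last equation of the even case puts \<open>m\<close> between \<open>x\<close> and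
  \<open>y\<close>; convexity of a spider then keeps the midpoint inside it.\<close>

lemma resolving_cases:
  assumes "x \<in> V" "y \<in> V" "x \<noteq> y"
  obtains (odd) "resolving x y = V"
  | (even) m a b where "m \<in> V" "a \<in> nbrs m" "b \<in> nbrs m" "a \<noteq> b" "x \<in> branch m a"
      "y \<in> branch m b" "resolving x y = branch m a \<union> branch m b" "d x m + d m y = d x y"
proof (cases "even (d x y)")
  case True
  define h where "h = d x y div 2"
  have h: "d x y = h + h" using True by (auto simp: h_def)
  have "h > 0" using h dist_zero[of x y] assms by (cases h) auto
  obtain m where m: "m \<in> V" "d x m = h" "d m y = h"
    using point_between[of x y h] assms h by auto
  have "x \<noteq> m" "y \<noteq> m" using m \<open>h > 0\<close> assms by auto
  then obtain a b where ab: "a \<in> nbrs m" "b \<in> nbrs m" "x \<in> branch m a" "y \<in> branch m b"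
    using branch_exists m assms by meson
  \<comment> \<open>In a common branch both endpoints could turn at \<open>a\<close>, so their
    distance would be at most \<open>2h - 2\<close>.\<close>
  have "a \<noteq> b"
  proof
    assume "a = b"
    then have "d m x = Suc (d a x)" "d m y = Suc (d a y)" using mem_branch_iff m ab assms by auto
    moreover have "d x y \<le> d x a + d a y" using triangle assms ab nbrsD by blast
    moreover have "d x a = d a x" "d x m = d m x" using dist_sym assms ab m nbrsD by blast+
    ultimately show False using m h by linarith
  qed
  moreover have "resolving x y = branch m a \<union> branch m b"
    using resolving_even[of m a b x y] m ab dist_sym assms \<open>a \<noteq> b\<close> by auto
  ultimately show thesis using even[of m a b] m ab h by auto
next
  case False
  then show thesis using odd resolving_odd assms by blast
qed

section \<open>Legs are whole branches\<close>

lemma leg_eq_branch: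
  assumes v: "v \<in> V" and a: "a \<in> nbrs v" and u: "u \<in> branch v a"
    and deg: "\<And>x. x \<in> leg v u \<Longrightarrow> card (nbrs x) \<le> 2" and leaf: "card (nbrs u) = 1"
  shows "leg v u = branch v a"
proof
  have uV: "u \<in> V" "u \<noteq> v" using u v by (auto simp: branch_def)
  show "leg v u \<subseteq> branch v a"
  proof
    fix x assume x: "x \<in> leg v u"
    show "x \<in> branch v a"
    proof (rule ccontr)
      assume "x \<notin> branch v a"
      then have "d u x = d u v + d v x" using dist_through_root v a u x by (auto simp: leg_def)
      then have "d v x = 0" using x dist_sym[of u x] dist_sym[of u v] uV v by (auto simp: leg_def)
      then show False using x v dist_zero[of v x] by (auto simp: leg_def)
    qed
  qed
  have a': "a \<in> leg v u"
    using a mem_branch_iff[OF v a, of u] u uV v dist_zero[of v a] by (auto simp: leg_def nbrs_def)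
  \<comment> \<open>The leg is closed under passing to neighbours other than \<open>v\<close>. With
    degree at most two, the only neighbours of \<open>x\<close> are its parents towards
    \<open>v\<close> and towards \<open>u\<close>, both on the path; at \<open>u\<close> itself the
    leaf condition leaves only the former. So the leg exhausts the branch.\<close>
  have closed: "y \<in> leg v u" if x: "x \<in> leg v u" and y: "y \<in> nbrs x" "y \<noteq> v" for x y
  proof -
    have xV: "x \<in> V" "x \<noteq> v" and xeq: "d v x + d x u = d v u" using x by (auto simp: leg_def)
    have yV: "y \<in> V" "d x y = 1" using y by (auto simp: nbrs_def)
    obtain p where p: "p \<in> V" "d x p = 1" "d v x = Suc (d v p)"
      using parent_exists[of v x] xV v by auto
    have tr: "d v u \<le> d v z + d z u" "d z u \<le> d z x + d x u" if "z \<in> V" for z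
      using triangle that v uV xV by blast+
    have "d p x = 1" using dist_sym p xV by auto
    then have pl: "d v p + d p u = d v u" using tr[of p] p xeq by auto
    show ?thesis
    proof (cases "y = p")
      case True
      then show ?thesis using pl yV y by (auto simp: leg_def)
    next
      case False
      have "x \<noteq> u"
      proof
        assume "x = u"
        then have "{y, p} \<subseteq> nbrs u" using y p by (auto simp: nbrs_def)
        then have "card {y, p} \<le> card (nbrs u)" by (intro card_mono) auto
        then show False using False leaf by auto
      qed
      then obtain c where c: "c \<in> V" "d x c = 1" "d u x = Suc (d u c)"
        using parent_exists[of u x] xV uV by auto
      have s: "d u x = d x u" "d u c = d c u" "d u p = d p u" using dist_sym uV xV c p by auto
      have "c \<noteq> p" using c p s pl xeq by auto
      have "y = c"
      proof (rule ccontr)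
        assume "y \<noteq> c"
        then have "card {y, p, c} = 3" using False \<open>c \<noteq> p\<close> by auto
        moreover have "{y, p, c} \<subseteq> nbrs x" using y p c by (auto simp: nbrs_def)
        then have "card {y, p, c} \<le> card (nbrs x)" by (intro card_mono) auto
        ultimately show False using deg[OF x] by auto
      qed
      moreover have "d v c \<le> d v x + d x c" using triangle v xV c by blast
      moreover have "d v u \<le> d v c + d c u" using tr c by blast
      ultimately show ?thesis using c s xeq y by (auto simp: leg_def)
    qed
  qed
  show "branch v a \<subseteq> leg v u"
  proof
    fix z assume "z \<in> branch v a"
    then show "z \<in> leg v u"
    proof (induction "d a z" arbitrary: z)
      case 0
      then show ?case using a a' dist_zero[of a z] by (auto simp: nbrs_def branch_def)
    next
      case (Suc n)
      have zV: "z \<in> V" "a \<in> V" using Suc a by (auto simp: branch_def nbrs_def)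
      then obtain p where p: "p \<in> V" "d z p = 1" "d a z = Suc (d a p)"
        using parent_exists[of a z] Suc dist_zero[of a z] by auto
      have pn: "p \<in> nbrs z" using p by (simp add: nbrs_def)
      have "p \<in> branch v a"
      proof (rule ccontr)
        assume "p \<notin> branch v a"
        then have "z = a" using branch_boundary[OF v a Suc.prems pn] by auto
        then show False using p zV by auto
      qed
      then have "p \<in> leg v u" using Suc p by auto
      moreover have "z \<in> nbrs p" using nbrs_sym pn zV by blast
      moreover have "z \<noteq> v" using Suc.prems root_not_mem_branch v by blast
      ultimately show ?case using closed by blast
    qed
  qed
qed

text \<open>Such a vertex would be a major vertex other than \<open>v\<close> and no farther from
  \<open>u\<close> than \<open>v\<close>. This supplies the degree bound of
  \<open>leg_eq_branch\<close>.\<close>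

lemma leg_not_major:
  assumes "major v" "u \<in> terminals v" "x \<in> leg v u"
  shows "\<not> major x"
proof
  assume "major x"
  then have "d u v < d u x" using assms by (auto simp: terminals_def leg_def)
  moreover have "d u v = d v u" "d u x = d x u"
    using assms dist_sym by (auto simp: terminals_def leg_def major_def)
  ultimately show False using assms by (auto simp: leg_def)
qed

lemma leg_is_branch:
  assumes v: "major v" and u: "u \<in> terminals v"
  shows "\<exists>a\<in>nbrs v. u \<in> branch v a \<and> leg v u = branch v a"
proof -
  have vV: "v \<in> V" using v majorD by blast
  have uV: "u \<in> V" "card (nbrs u) = 1" "u \<noteq> v" using u v by (auto simp: terminals_def major_def)
  obtain a where a: "a \<in> nbrs v" "u \<in> branch v a" using branch_exists uV vV by blast
  have "card (nbrs x) \<le> 2" if "x \<in> leg v u" for x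
    using leg_not_major[OF v u that] that by (auto simp: major_def leg_def)
  then have "leg v u = branch v a" using leg_eq_branch[OF vV a] uV by blast
  then show ?thesis using a by blast
qed

lemma terminal_unique:
  assumes "major v" "u \<in> terminals v" "u' \<in> terminals v" "leg v u = leg v u'"
  shows "u = u'"
proof (rule ccontr)
  assume ne: "u \<noteq> u'"
  have V: "v \<in> V" "u \<in> V" "u' \<in> V" "u \<noteq> v" "u' \<noteq> v" using assms by (auto simp: terminals_def major_def)
  then have "u \<in> leg v u" "u' \<in> leg v u'" by (auto simp: leg_def)
  then have "u' \<in> leg v u" "u \<in> leg v u'" using assms(4) by blast+
  then have "d v u' + d u' u = d v u" "d v u + d u u' = d v u'" by (auto simp: leg_def)
  then have "d u u' = 0" by simp
  then show False using V dist_zero ne by blast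
qed

lemma legs_disjoint_same:
  assumes "major v" "u \<in> terminals v" "u' \<in> terminals v" "u \<noteq> u'"
  shows "leg v u \<inter> leg v u' = {}"
proof -
  obtain a where a: "a \<in> nbrs v" "leg v u = branch v a" using leg_is_branch assms(1,2) by blast
  obtain b where b: "b \<in> nbrs v" "leg v u' = branch v b" using leg_is_branch assms(1,3) by blast
  have "a \<noteq> b" using terminal_unique assms a b by auto
  then show ?thesis using branch_unique a b majorD assms(1) by blast
qed

text \<open>No leg contains a major vertex, so neither root lies in the other's leg. A common vertex
  would reach \<open>v'\<close> through \<open>v\<close> and \<open>v\<close> through
  \<open>v'\<close>, which forces \<open>d v v' = 0\<close>.\<close>

lemma legs_disjoint_other:
  assumes "major v" "u \<in> terminals v" "major v'" "u' \<in> terminals v'" "v \<noteq> v'"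
  shows "leg v u \<inter> leg v' u' = {}"
proof (rule ccontr)
  assume "leg v u \<inter> leg v' u' \<noteq> {}"
  then obtain x where x: "x \<in> leg v u" "x \<in> leg v' u'" by blast
  obtain a where a: "a \<in> nbrs v" "leg v u = branch v a" "v' \<notin> leg v u"
    using leg_is_branch[of v u] leg_not_major[of v u v'] assms by blast
  obtain b where b: "b \<in> nbrs v'" "leg v' u' = branch v' b" "v \<notin> leg v' u'"
    using leg_is_branch[of v' u'] leg_not_major[of v' u' v] assms by blast
  have V: "v \<in> V" "v' \<in> V" using assms majorD by auto
  have "d x v' = d x v + d v v'" using dist_through_root V a x by auto
  moreover have "d x v = d x v' + d v' v" using dist_through_root V b x by auto
  ultimately have "d v v' = 0" by auto
  then show False using dist_zero V assms by blast
qed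

text \<open>The terminal vertex is a vertex of the branch at maximal distance from \<open>v\<close>:
  none of its neighbours is farther from \<open>v\<close>, so its parent is the only one. Every
  major vertex other than \<open>v\<close> is reached from it through \<open>v\<close>.\<close>

lemma terminal_of_branch:
  assumes v: "major v" and a: "a \<in> nbrs v" and nm: "\<And>w. w \<in> branch v a \<Longrightarrow> \<not> major w"
  obtains u where "u \<in> terminals v" "leg v u = branch v a"
proof -
  have vV: "v \<in> V" using v majorD by blast
  have fin: "finite (branch v a)" using finite_V branch_subset finite_subset by blast
  define D where "D = Max (d v ` branch v a)"
  have "D \<in> d v ` branch v a" unfolding D_def
    using fin nbr_mem_branch[OF a] by (intro Max_in) auto
  then obtain u where u: "u \<in> branch v a" "d v u = D" by auto
  have far: "d v z \<le> d v u" if "z \<in> branch v a" for z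
    using that fin u by (auto simp: D_def)
  have uV: "u \<in> V" "u \<noteq> v" using u vV by (auto simp: branch_def)
  obtain p where p: "p \<in> V" "d u p = 1" "d v u = Suc (d v p)"
    using parent_exists[of v u] uV vV by auto
  have "nbrs u = {p}"
  proof (intro equalityI subsetI)
    fix q assume q: "q \<in> nbrs u"
    show "q \<in> {p}"
    proof (cases "q \<in> branch v a")
      case True
      then show ?thesis
        using far[OF True] q p parent_unique[of v u q p] uV vV by (auto simp: nbrs_def)
    next
      case False
      then have "q = v" using branch_boundary[OF vV a] u q by blast
      then show ?thesis using q p uV vV parent_unique[of v u q p] by (auto simp: nbrs_def)
    qed
  qed (use p in \<open>auto simp: nbrs_def\<close>)
  then have leaf: "card (nbrs u) = 1" by simp
  have "d u v < d u w" if w: "major w" "w \<noteq> v" for w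
  proof -
    have "d u w = d u v + d v w"
      using dist_through_root[OF vV a u(1)] w nm majorD by blast
    then show ?thesis using w vV dist_zero[of v w] majorD[of w] by auto
  qed
  then have "u \<in> terminals v" using uV leaf by (auto simp: terminals_def)
  moreover obtain b where b: "b \<in> nbrs v" "u \<in> branch v b" "leg v u = branch v b"
    using leg_is_branch[OF v \<open>u \<in> terminals v\<close>] by blast
  moreover have "a = b" using branch_unique vV a b u by blast
  ultimately show thesis using that by blast
qed

text \<open>A major vertex of the branch at maximal distance from the root has only major-free branches
  pointing away from the root, and these are legs.\<close>

lemma two_legs_in_branch:
  assumes m: "m \<in> V" and a: "a \<in> nbrs m" and x: "x \<in> branch m a" "major x"
  obtains v u u' where "major v" "u \<in> terminals v" "u' \<in> terminals v" "u \<noteq> u'"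
    "leg v u \<subseteq> branch m a" "leg v u' \<subseteq> branch m a"
proof -
  define S where "S = {w \<in> branch m a. major w}"
  have fin: "finite S" using finite_V by (simp add: S_def branch_def)
  define D where "D = Max (d m ` S)"
  have "D \<in> d m ` S" unfolding D_def using fin x by (intro Max_in) (auto simp: S_def)
  then obtain w where w: "w \<in> branch m a" "major w" "d m w = D" by (auto simp: S_def)
  have far: "d m z \<le> d m w" if "z \<in> branch m a" "major z" for z
    using that fin w by (auto simp: D_def S_def)
  have wV: "w \<in> V" "w \<noteq> m" using w m by (auto simp: branch_def)
  obtain p where p: "p \<in> nbrs w" "m \<in> branch w p" using branch_exists wV m by metis
  have leg: "\<exists>u \<in> terminals w. leg w u = branch w b \<and> branch w b \<subseteq> branch m a"
    if b: "b \<in> nbrs w" "b \<noteq> p" for b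
  proof -
    have mb: "m \<notin> branch w b" using branch_unique wV p b by blast
    have zd: "d m z = d m w + d w z" "d w z > 0" if z: "z \<in> branch w b" for z
    proof -
      have zV: "z \<in> V" using z branch_subset by blast
      have "d z m = d z w + d w m" using dist_through_root wV b z m mb by blast
      then show "d m z = d m w + d w z" using dist_sym zV wV m by auto
      show "d w z > 0" using z by (auto simp: branch_def)
    qed
    have sub: "branch w b \<subseteq> branch m a"
    proof
      fix z assume z: "z \<in> branch w b"
      have zV: "z \<in> V" using z branch_subset by blast
      show "z \<in> branch m a"
      proof (rule ccontr)
        assume "z \<notin> branch m a"
        then have "d w z = d w m + d m z" using dist_through_root[OF m a w(1), of z] zV by blast
        then have "d w m = 0" using zd[OF z] dist_sym[of w m] wV m by auto
        then show False using dist_zero wV m by blast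
      qed
    qed
    have "\<not> major z" if "z \<in> branch w b" for z
      using far[of z] zd[OF that] sub that by auto
    then show ?thesis using terminal_of_branch[OF w(2) b(1)] sub by metis
  qed
  have "card (nbrs w - {p}) = card (nbrs w) - 1" using p by simp
  then have "2 \<le> card (nbrs w - {p})" using w(2) unfolding major_def by linarith
  then obtain b b' where b: "b \<in> nbrs w - {p}" "b' \<in> nbrs w - {p}" "b \<noteq> b'"
    using obtain_two by metis
  obtain u where u: "u \<in> terminals w" "leg w u = branch w b" "branch w b \<subseteq> branch m a"
    using leg b by blast
  obtain u' where u': "u' \<in> terminals w" "leg w u' = branch w b'" "branch w b' \<subseteq> branch m a"
    using leg b by blast
  have "u \<noteq> u'" 
  proof
    assume "u = u'"
    then have "b \<in> branch w b'" using u u' nbr_mem_branch b by auto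
    then show False using branch_unique wV b nbr_mem_branch by blast
  qed
  then show thesis using that[of w u u'] w u u' by auto
qed

text \<open>If no branch at \<open>x\<close> contains a major vertex, every branch at
  \<open>x\<close> is a leg. This serves the case in which the resolving set is the whole tree and
  no branch is singled out.\<close>

lemma two_legs_exist:
  assumes "major x"
  obtains v u u' where "major v" "u \<in> terminals v" "u' \<in> terminals v" "u \<noteq> u'"
proof (cases "\<exists>a\<in>nbrs x. \<exists>w\<in>branch x a. major w")
  case True
  then show thesis using two_legs_in_branch majorD assms that by metis
next
  case False
  have "2 \<le> card (nbrs x)" using assms by (simp add: major_def)
  then obtain b b' where b: "b \<in> nbrs x" "b' \<in> nbrs x" "b \<noteq> b'"
    using obtain_two by metis
  obtain u where u: "u \<in> terminals x" "leg x u = branch x b"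
    using terminal_of_branch[OF assms b(1)] False b by blast
  obtain u' where u': "u' \<in> terminals x" "leg x u' = branch x b'"
    using terminal_of_branch[OF assms b(2)] False b by blast
  have "u \<noteq> u'" 
  proof
    assume "u = u'"
    then have "b \<in> branch x b'" using u u' nbr_mem_branch b by auto
    then show False using branch_unique majorD assms b nbr_mem_branch by blast
  qed
  then show thesis using that assms u u' by blast
qed

lemma leg_subset: "leg v u \<subseteq> V"
  by (auto simp: leg_def)

lemma finite_terminals [simp]: "finite (terminals v)"
  using finite_V by (simp add: terminals_def)

lemma star_majorsI:
  assumes "major v" "u \<in> terminals v" "u' \<in> terminals v" "u \<noteq> u'"
  shows "v \<in> star_majors"
proof -
  have "card {u, u'} \<le> card (terminals v)" using assms by (intro card_mono) auto
  then show ?thesis using assms by (auto simp: star_majors_def)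
qed

lemma two_legs_in_resolving:
  assumes x: "x \<in> V" "y \<in> V" "x \<noteq> y" and major: "\<exists>v. major v"
  obtains v u u' where "v \<in> star_majors" "u \<in> terminals v" "u' \<in> terminals v" "u \<noteq> u'"
    "leg v u \<union> leg v u' \<subseteq> resolving x y"
  using x
proof (cases rule: resolving_cases)
  case odd
  then show thesis using two_legs_exist major that leg_subset star_majorsI by (metis le_sup_iff)
next
  case (even m a b)
  show thesis
  proof (cases "\<exists>w\<in>branch m a \<union> branch m b. major w")
    case True
    then obtain c w where c: "c \<in> nbrs m" "branch m c \<subseteq> resolving x y" "w \<in> branch m c" "major w"
      using even by auto
    then obtain v u u' where "major v" "u \<in> terminals v" "u' \<in> terminals v" "u \<noteq> u'"
      "leg v u \<subseteq> branch m c" "leg v u' \<subseteq> branch m c"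
      using two_legs_in_branch even(1) by metis
    then show thesis using that[of v u u'] c(2) star_majorsI by auto
  next
    case False
    \<comment> \<open>Some major vertex exists. Were it neither \<open>m\<close> nor in the two
      branches, it would lie in a third branch and give \<open>m\<close> a third neighbour.\<close>
    have "major m"
    proof (rule ccontr)
      assume nm: "\<not> major m"
      obtain w where w: "major w" "w \<in> V" using major majorD by blast
      then have "w \<noteq> m" using nm by auto
      then obtain c where c: "c \<in> nbrs m" "w \<in> branch m c" using branch_exists w even(1) by blast
      then have "c \<noteq> a" "c \<noteq> b" using False w by auto
      then have "card {a, b, c} = 3" using even by auto
      moreover have "card {a, b, c} \<le> card (nbrs m)" using c even by (intro card_mono) auto
      ultimately show False using nm even by (simp add: major_def)
    qed
    obtain u where u: "u \<in> terminals m" "leg m u = branch m a"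
      using terminal_of_branch[OF \<open>major m\<close> even(2)] False by blast
    obtain u' where u': "u' \<in> terminals m" "leg m u' = branch m b"
      using terminal_of_branch[OF \<open>major m\<close> even(3)] False by blast
    have "u \<noteq> u'" using u u' even branch_unique nbr_mem_branch by metis
    then show thesis using that[of m u u'] u u' even star_majorsI \<open>major m\<close> by auto
  qed
qed

text \<open>The witnesses are the first vertices of the two legs: both are adjacent to
  \<open>v\<close>, so \<open>v\<close> is their midpoint.\<close>

lemma resolving_two_legs:
  assumes v: "major v" and u: "u \<in> terminals v" "u' \<in> terminals v" "u \<noteq> u'"
  obtains x y where "x \<in> leg v u" "y \<in> leg v u'" "x \<noteq> y" "resolving x y = leg v u \<union> leg v u'"
proof -
  obtain a where a: "a \<in> nbrs v" "leg v u = branch v a" using leg_is_branch v u(1) by blast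
  obtain b where b: "b \<in> nbrs v" "leg v u' = branch v b" using leg_is_branch v u(2) by blast
  have "a \<noteq> b" using terminal_unique v u a b by auto
  then have "resolving a b = branch v a \<union> branch v b"
    using resolving_even[of v a b a b] a b nbr_mem_branch majorD[OF v] by (auto simp: nbrs_def)
  then show thesis using that[of a b] a b nbr_mem_branch \<open>a \<noteq> b\<close> by auto
qed

section \<open>The vertex set of \<open>T\<^sub>v\<close>\<close>

definition spider :: "'a \<Rightarrow> 'a set" where
  "spider v = insert v (\<Union>u\<in>terminals v. leg v u)"

text \<open>Since legs are whole branches, the branch at \<open>v\<close> of a vertex
  \<open>z\<close> outside the spider contains no spider vertex. Both \<open>x\<close> and
  \<open>y\<close> are then reached from \<open>z\<close> through \<open>v\<close>, and betweenness
  forces \<open>z = v\<close>.\<close>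

lemma spider_convex:
  assumes v: "major v" and x: "x \<in> spider v" and y: "y \<in> spider v"
    and z: "z \<in> V" "d x z + d z y = d x y"
  shows "z \<in> spider v"
proof (rule ccontr)
  assume nz: "z \<notin> spider v"
  have vV: "v \<in> V" using v majorD by blast
  have V: "x \<in> V" "y \<in> V" using x y vV by (auto simp: spider_def leg_def)
  have "z \<noteq> v" using nz by (auto simp: spider_def)
  then obtain c where c: "c \<in> nbrs v" "z \<in> branch v c" using branch_exists vV z by blast
  have out: "w \<notin> branch v c" if w: "w \<in> spider v" for w
  proof
    assume wc: "w \<in> branch v c"
    then obtain u where u: "u \<in> terminals v" "w \<in> leg v u"
      using w root_not_mem_branch vV by (auto simp: spider_def)
    obtain a where a: "a \<in> nbrs v" "leg v u = branch v a" using leg_is_branch v u(1) by blast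
    have "a = c" using branch_unique vV a c wc u by blast
    then show False using nz a u c by (auto simp: spider_def)
  qed
  have "d z x = d z v + d v x" "d z y = d z v + d v y"
    using dist_through_root vV c V out x y by blast+
  moreover have "d x y \<le> d x v + d v y" using triangle V vV by blast
  ultimately have "d z v = 0" using z dist_sym[of z x] dist_sym[of v x] V vV by auto
  then show False using dist_zero z vV \<open>z \<noteq> v\<close> by blast
qed

text \<open>A midpoint at \<open>v\<close> yields two legs. A midpoint inside a leg has at most two
  neighbours, so the branches of \<open>x\<close> and \<open>y\<close> at it cover everything else;
  this is the case \<open>point\<close>.\<close>

lemma spider_resolving:
  assumes v: "major v" "2 \<le> card (terminals v)" and x: "x \<in> spider v" "y \<in> spider v" "x \<noteq> y"
  obtains (legs) u u' where "u \<in> terminals v" "u' \<in> terminals v" "u \<noteq> u'"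
      "leg v u \<union> leg v u' \<subseteq> resolving x y"
  | (point) w u where "u \<in> terminals v" "w \<in> leg v u" "resolving x y = V - {w}"
proof -
  have vV: "v \<in> V" using v majorD by blast
  have V: "x \<in> V" "y \<in> V" using x vV by (auto simp: spider_def leg_def)
  obtain u u' where uu: "u \<in> terminals v" "u' \<in> terminals v" "u \<noteq> u'"
    using obtain_two v(2) by metis
  show thesis
    using V x(3)
  proof (cases rule: resolving_cases)
    case odd
    then show thesis using legs uu leg_subset by (metis le_sup_iff)
  next
    case (even m a b)
    have "m \<in> spider v" using spider_convex v x even by blast
    show thesis
    proof (cases "m = v")
      case True
      have hit: "\<exists>u\<in>terminals v. w \<in> leg v u \<and> leg v u = branch v c"
        if w: "w \<in> spider v" and c: "c \<in> nbrs v" "w \<in> branch v c" for w c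
      proof -
        obtain u where u: "u \<in> terminals v" "w \<in> leg v u"
          using w c root_not_mem_branch vV by (auto simp: spider_def)
        obtain a where a: "a \<in> nbrs v" "leg v u = branch v a" using leg_is_branch v u(1) by blast
        have "a = c" using branch_unique vV a c u by blast
        then show ?thesis using a u by auto
      qed
      obtain t where t: "t \<in> terminals v" "leg v t = branch v a" using hit[OF x(1), of a] even True by auto
      obtain t' where t': "t' \<in> terminals v" "leg v t' = branch v b" using hit[OF x(2), of b] even True by auto
      have "t \<noteq> t'" using t t' even True branch_unique nbr_mem_branch by metis
      then show thesis using legs[of t t'] t t' even True by auto
    next
      case False
      then obtain t where t: "t \<in> terminals v" "m \<in> leg v t" using \<open>m \<in> spider v\<close> by (auto simp: spider_def)
      have "\<not> major m" using leg_not_major v t by blast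
      then have c2: "card (nbrs m) \<le> 2" using even by (auto simp: major_def)
      have "z \<in> resolving x y" if z: "z \<in> V" "z \<noteq> m" for z
      proof -
        obtain c where c: "c \<in> nbrs m" "z \<in> branch m c" using branch_exists z even by blast
        have "c = a \<or> c = b"
        proof (rule ccontr)
          assume "\<not> (c = a \<or> c = b)"
          then have "card {a, b, c} = 3" using even by auto
          moreover have "card {a, b, c} \<le> card (nbrs m)" using c even by (intro card_mono) auto
          ultimately show False using c2 by simp
        qed
        then show ?thesis using c even by auto
      qed
      then have "resolving x y = V - {m}"
        using even root_not_mem_branch by (auto simp: branch_def)
      then show thesis using point t by blast
    qed
  qed
qed

end

section \<open>The linear program of disjoint legs\<close>

text \<open>The least total weight of legs of sizes \<open>l u\<close> that weigh at least \<open>k\<close> in pairs: a shortest leg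
  gets weight \<open>a\<close> and every other leg \<open>k - a\<close>.\<close>

definition legs_cost :: "real \<Rightarrow> 'u set \<Rightarrow> ('u \<Rightarrow> nat) \<Rightarrow> real" where
  "legs_cost k U l = (let a = min (k / 2) (real (Min (l ` U))) in a + (real (card U) - 1) * (k - a))"

text \<open>The two weights \<open>a\<close> and \<open>k - a\<close> add up to \<open>k\<close>
  whatever the leg lengths; this is the origin of the term \<open>k\<close> for each vertex of
  terminal degree two.\<close>

lemma legs_cost_two: "card U = 2 \<Longrightarrow> legs_cost k U l = k"
  by (simp add: legs_cost_def Let_def)

text \<open>If a leg has weight \<open>t \<le> a\<close>, the others weigh at least
  \<open>k - t\<close> each, and the total \<open>t + (n - 1) * (k - t)\<close> is nonincreasing in
  \<open>t\<close>, hence least at \<open>t = a\<close>. If all legs weigh more than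
  \<open>a\<close>, so does a shortest one; then \<open>a\<close> is not its length but
  \<open>k / 2\<close>, and \<open>n\<close> legs weigh at least \<open>n * k / 2\<close>.\<close>

lemma legs_cost_lower:
  fixes x :: "'u \<Rightarrow> real"
  assumes U: "finite U" "2 \<le> card U" and bound: "\<And>u. u \<in> U \<Longrightarrow> x u \<le> real (l u)"
    and pair: "\<And>u w. u \<in> U \<Longrightarrow> w \<in> U \<Longrightarrow> u \<noteq> w \<Longrightarrow> k \<le> x u + x w"
  shows "legs_cost k U l \<le> sum x U"
proof -
  define n where "n = real (card U)"
  define a where "a = min (k / 2) (real (Min (l ` U)))"
  have n: "2 \<le> n" using U by (simp add: n_def)
  have cost: "legs_cost k U l = a + (n - 1) * (k - a)"
    by (simp add: legs_cost_def a_def n_def)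
  have "U \<noteq> {}" using U by auto
  then have "Min (l ` U) \<in> l ` U" using U by (intro Min_in) auto
  then obtain w where w: "w \<in> U" "l w = Min (l ` U)" by auto
  show ?thesis
  proof (cases "\<exists>u\<in>U. x u \<le> a")
    case True
    then obtain u where u: "u \<in> U" "x u \<le> a" by blast
    have "real (card (U - {u})) * (k - x u) \<le> sum x (U - {u})"
      using pair[OF _ u(1)] by (intro sum_bounded_below) (auto simp: algebra_simps)
    moreover have "real (card (U - {u})) = n - 1" using U u by (simp add: n_def of_nat_diff)
    moreover have "sum x U = x u + sum x (U - {u})" using U u by (simp add: sum.remove)
    ultimately have "x u + (n - 1) * (k - x u) \<le> sum x U" by simp
    moreover have "(n - 2) * x u \<le> (n - 2) * a" using n u by (intro mult_left_mono) auto
    ultimately show ?thesis unfolding cost by (simp add: algebra_simps)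
  next
    case False
    then have "a < x w" using w by force
    then have a: "a = k / 2" using bound[OF w(1)] w(2) by (auto simp: a_def min_def split: if_splits)
    have "n * a \<le> sum x U" unfolding n_def using False by (intro sum_bounded_below) force
    moreover have "a + (n - 1) * (k - a) = n * a" unfolding a by (simp add: field_simps)
    ultimately show ?thesis unfolding cost by simp
  qed
qed

text \<open>Two legs other than the shortest weigh \<open>2 * (k - a) \<ge> k\<close> because
  \<open>a \<le> k / 2\<close>. The weight \<open>k - a\<close> fits on them: either
  \<open>a = k / 2\<close>, and they are no shorter than the leg carrying \<open>a\<close>, or the
  shortest leg is full and the assumption on pairs of sizes applies.\<close>

lemma legs_cost_attained:
  assumes U: "finite U" "2 \<le> card U" and k: "0 \<le> k"
    and pair: "\<And>u w. u \<in> U \<Longrightarrow> w \<in> U \<Longrightarrow> u \<noteq> w \<Longrightarrow> k \<le> real (l u) + real (l w)"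
  obtains x :: "'u \<Rightarrow> real" where "\<And>u. u \<in> U \<Longrightarrow> 0 \<le> x u \<and> x u \<le> real (l u)"
    "\<And>u w. u \<in> U \<Longrightarrow> w \<in> U \<Longrightarrow> u \<noteq> w \<Longrightarrow> k \<le> x u + x w" "sum x U = legs_cost k U l"
proof -
  define a where "a = min (k / 2) (real (Min (l ` U)))"
  have "U \<noteq> {}" using U by auto
  then have "Min (l ` U) \<in> l ` U" using U by (intro Min_in) auto
  then obtain w where w: "w \<in> U" "l w = Min (l ` U)" by auto
  have min: "l w \<le> l u" if "u \<in> U" for u using U that w by simp
  define x where "x u = (if u = w then a else k - a)" for u
  have a: "0 \<le> a" "a \<le> k / 2" "a \<le> real (l w)" using k w by (auto simp: a_def)
  have bound: "k - a \<le> real (l u)" if u: "u \<in> U" "u \<noteq> w" for u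
  proof (cases "a = k / 2")
    case True
    then show ?thesis using a min[OF u(1)] by (simp add: field_simps)
  next
    case False
    then have "a = real (l w)" using w by (auto simp: a_def min_def split: if_splits)
    then show ?thesis using pair[OF u(1) w(1) u(2)] by simp
  qed
  have "sum x U = x w + sum x (U - {w})" using U w by (simp add: sum.remove)
  also have "sum x (U - {w}) = (\<Sum>u\<in>U - {w}. k - a)" by (intro sum.cong) (auto simp: x_def)
  also have "x w + \<dots> = a + (real (card U) - 1) * (k - a)"
    using U w by (simp add: x_def of_nat_diff)
  finally have total: "sum x U = legs_cost k U l" by (simp add: legs_cost_def a_def)
  show thesis
  proof (rule that[OF _ _ total])
    fix u assume "u \<in> U"
    then show "0 \<le> x u \<and> x u \<le> real (l u)" using a bound[of u] by (simp add: x_def)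
  next
    fix u v assume "u \<in> U" "v \<in> U" "u \<noteq> v"
    then show "k \<le> x u + x v" using a by (auto simp: x_def)
  qed
qed

section \<open>From leg weights to kappa and resolving functions\<close>

lemma metric_kappa_eqI:
  assumes "finite (verts G)" and S: "finite S" "S \<noteq> {}"
    and realized: "\<And>n. n \<in> S \<Longrightarrow>
      \<exists>x\<in>verts G. \<exists>y\<in>verts G. x \<noteq> y \<and> card (resolving_set G x y) = n"
    and lower: "\<And>x y. x \<in> verts G \<Longrightarrow> y \<in> verts G \<Longrightarrow> x \<noteq> y \<Longrightarrow>
      \<exists>n\<in>S. n \<le> card (resolving_set G x y)"
  shows "metric_kappa G = Min S"
proof -
  let ?K = "{card (resolving_set G x y) | x y. x \<in> verts G \<and> y \<in> verts G \<and> x \<noteq> y}"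
  have "?K \<subseteq> (\<lambda>(x, y). card (resolving_set G x y)) ` (verts G \<times> verts G)" by auto
  then have fin: "finite ?K" by (rule finite_subset) (use assms(1) in simp)
  have "Min S \<in> ?K" using realized[OF Min_in[OF S]] by (force simp del: Min_in)
  moreover have "Min S \<le> n" if n: "n \<in> ?K" for n
  proof -
    obtain m where "m \<in> S" "m \<le> n" using n lower by blast
    then show ?thesis using S by (meson Min_le order_trans)
  qed
  ultimately show ?thesis unfolding metric_kappa_def using fin by (intro Min_eqI) auto
qed

lemma Min_Union:
  fixes A :: "'i \<Rightarrow> nat set"
  assumes "finite I" "I \<noteq> {}" "\<And>i. i \<in> I \<Longrightarrow> finite (A i) \<and> A i \<noteq> {}"
  shows "Min (\<Union>i\<in>I. A i) = Min ((\<lambda>i. Min (A i)) ` I)"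
proof (rule Min_eqI)
  show "finite (\<Union>i\<in>I. A i)" using assms by blast
  fix n assume "n \<in> (\<Union>i\<in>I. A i)"
  then obtain i where i: "i \<in> I" "n \<in> A i" by blast
  have "Min ((\<lambda>i. Min (A i)) ` I) \<le> Min (A i)" using i assms by (intro Min_le) auto
  also have "\<dots> \<le> n" using i assms by (intro Min_le) auto
  finally show "Min ((\<lambda>i. Min (A i)) ` I) \<le> n" .
next
  have "Min ((\<lambda>i. Min (A i)) ` I) \<in> (\<lambda>i. Min (A i)) ` I" using assms by (intro Min_in) auto
  then obtain i where i: "i \<in> I" "Min ((\<lambda>i. Min (A i)) ` I) = Min (A i)" by auto
  then show "Min ((\<lambda>i. Min (A i)) ` I) \<in> (\<Union>i\<in>I. A i)" using Min_in assms by fastforce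
qed

text \<open>The index set is left abstract so that one statement covers \<open>T\<close>, with all
  of \<open>M\<^sup>*\<close>, and \<open>T\<^sub>v\<close>, with a single index. The bound on
  \<open>k\<close> by pairs of leg sizes makes the program feasible with values at most 1.\<close>

lemma frac_metric_dim_legs:
  fixes G :: "('a, 'b) pre_digraph" and L :: "'i \<Rightarrow> 'u \<Rightarrow> 'a set"
  assumes finG: "finite (verts G)" and finI: "finite I"
    and U: "\<And>v. v \<in> I \<Longrightarrow> finite (U v) \<and> 2 \<le> card (U v)"
    and L: "\<And>v u. v \<in> I \<Longrightarrow> u \<in> U v \<Longrightarrow> L v u \<subseteq> verts G \<and> L v u \<noteq> {}"
    and disj: "\<And>v u v' u'. \<lbrakk>v \<in> I; u \<in> U v; v' \<in> I; u' \<in> U v'; (v, u) \<noteq> (v', u')\<rbrakk> \<Longrightarrow>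
      L v u \<inter> L v' u' = {}"
    and realized: "\<And>v u u'. \<lbrakk>v \<in> I; u \<in> U v; u' \<in> U v; u \<noteq> u'\<rbrakk> \<Longrightarrow>
      \<exists>x\<in>verts G. \<exists>y\<in>verts G. x \<noteq> y \<and> resolving_set G x y = L v u \<union> L v u'"
    and contained: "\<And>x y. \<lbrakk>x \<in> verts G; y \<in> verts G; x \<noteq> y\<rbrakk> \<Longrightarrow>
      \<exists>v\<in>I. \<exists>u\<in>U v. \<exists>u'\<in>U v. u \<noteq> u' \<and> L v u \<union> L v u' \<subseteq> resolving_set G x y"
    and k: "0 \<le> k" "\<And>v u u'. \<lbrakk>v \<in> I; u \<in> U v; u' \<in> U v; u \<noteq> u'\<rbrakk> \<Longrightarrow>
      k \<le> real (card (L v u)) + real (card (L v u'))"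
  shows "frac_metric_dim k G = (\<Sum>v\<in>I. legs_cost k (U v) (\<lambda>u. card (L v u)))"
proof -
  let ?P = "Sigma I U"
  let ?Lp = "\<lambda>(v, u). L v u"
  have finL: "finite (L v u)" if "v \<in> I" "u \<in> U v" for v u
    using finG L that finite_subset by blast
  have finP: "finite ?P" using finI U by auto
  have sum_legs: "sum g (\<Union>p\<in>?P. ?Lp p) = (\<Sum>v\<in>I. \<Sum>u\<in>U v. sum g (L v u))" for g :: "'a \<Rightarrow> real"
  proof -
    have "sum g (\<Union>p\<in>?P. ?Lp p) = (\<Sum>p\<in>?P. sum g (?Lp p))"
      using finP finL disj by (intro sum.UNION_disjoint) auto
    also have "\<dots> = (\<Sum>v\<in>I. \<Sum>u\<in>U v. sum g (L v u))"
      using finI U by (subst sum.Sigma) (auto simp: split_def)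
    finally show ?thesis .
  qed
  have sub: "(\<Union>p\<in>?P. ?Lp p) \<subseteq> verts G" using L by auto
  have "\<forall>v\<in>I. \<exists>x. (\<forall>u\<in>U v. 0 \<le> x u \<and> x u \<le> real (card (L v u))) \<and>
      (\<forall>u\<in>U v. \<forall>w\<in>U v. u \<noteq> w \<longrightarrow> k \<le> x u + x w) \<and>
      sum x (U v) = legs_cost k (U v) (\<lambda>u. card (L v u))"
  proof
    fix v assume v: "v \<in> I"
    obtain x :: "'u \<Rightarrow> real" where "\<And>u. u \<in> U v \<Longrightarrow> 0 \<le> x u \<and> x u \<le> real (card (L v u))"
      "\<And>u w. u \<in> U v \<Longrightarrow> w \<in> U v \<Longrightarrow> u \<noteq> w \<Longrightarrow> k \<le> x u + x w"
      "sum x (U v) = legs_cost k (U v) (\<lambda>u. card (L v u))"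
      using legs_cost_attained[of "U v" k "\<lambda>u. card (L v u)"] U v k by blast
    then show "\<exists>x. (\<forall>u\<in>U v. 0 \<le> x u \<and> x u \<le> real (card (L v u))) \<and>
      (\<forall>u\<in>U v. \<forall>w\<in>U v. u \<noteq> w \<longrightarrow> k \<le> x u + x w) \<and>
      sum x (U v) = legs_cost k (U v) (\<lambda>u. card (L v u))" by blast
  qed
  then obtain X where "\<forall>v\<in>I. (\<forall>u\<in>U v. 0 \<le> X v u \<and> X v u \<le> real (card (L v u))) \<and>
      (\<forall>u\<in>U v. \<forall>w\<in>U v. u \<noteq> w \<longrightarrow> k \<le> X v u + X v w) \<and>
      sum (X v) (U v) = legs_cost k (U v) (\<lambda>u. card (L v u))"
    unfolding bchoice_iff ..
  then have X: "\<And>v u. v \<in> I \<Longrightarrow> u \<in> U v \<Longrightarrow> 0 \<le> X v u \<and> X v u \<le> real (card (L v u))"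
    "\<And>v u w. v \<in> I \<Longrightarrow> u \<in> U v \<Longrightarrow> w \<in> U v \<Longrightarrow> u \<noteq> w \<Longrightarrow> k \<le> X v u + X v w"
    "\<And>v. v \<in> I \<Longrightarrow> sum (X v) (U v) = legs_cost k (U v) (\<lambda>u. card (L v u))"
    by simp_all
  \<comment> \<open>The weight of each leg is spread evenly over its vertices, so a weight not
    exceeding the leg size keeps \<open>g\<close> at most 1. The legs being disjoint, at most one
    summand is nonzero.\<close>
  define g where "g z = (\<Sum>(v, u)\<in>?P. if z \<in> L v u then X v u / real (card (L v u)) else 0)" for z
  have g_leg: "g z = X v u / real (card (L v u))" if "v \<in> I" "u \<in> U v" "z \<in> L v u" for z v u
  proof -
    have "(case p of (v, u) \<Rightarrow> if z \<in> L v u then X v u / real (card (L v u)) else 0) =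
        (if p = (v, u) then X v u / real (card (L v u)) else 0)" if "p \<in> ?P" for p
      using disj[of v u "fst p" "snd p"] that \<open>v \<in> I\<close> \<open>u \<in> U v\<close> \<open>z \<in> L v u\<close>
      by (cases p) auto
    then have "g z = (\<Sum>p\<in>?P. if p = (v, u) then X v u / real (card (L v u)) else 0)"
      unfolding g_def by (rule sum.cong[OF refl])
    then show ?thesis using finP that by simp
  qed
  have g_off: "g z = 0" if "z \<notin> (\<Union>p\<in>?P. ?Lp p)" for z
    unfolding g_def by (rule sum.neutral) (use that in auto)
  have g_bounds: "0 \<le> g z \<and> g z \<le> 1" for z
  proof (cases "z \<in> (\<Union>p\<in>?P. ?Lp p)")
    case True
    then obtain v u where p: "v \<in> I" "u \<in> U v" "z \<in> L v u" by auto
    then have "0 < card (L v u)" using finL L card_gt_0_iff by blast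
    then show ?thesis using g_leg[OF p] X(1)[OF p(1,2)] by simp
  next
    case False
    then show ?thesis using g_off by simp
  qed
  have g_sum: "sum g (L v u) = X v u" if "v \<in> I" "u \<in> U v" for v u
  proof -
    have "sum g (L v u) = (\<Sum>z\<in>L v u. X v u / real (card (L v u)))"
      using g_leg that by (intro sum.cong) auto
    also have "\<dots> = X v u" using L[OF that] finL[OF that] by simp
    finally show ?thesis .
  qed
  have g_resolving: "k_resolving_function G k g"
    unfolding k_resolving_function_def
  proof (intro conjI ballI impI)
    fix x y assume xy: "x \<in> verts G" "y \<in> verts G" "x \<noteq> y"
    obtain v u u' where p: "v \<in> I" "u \<in> U v" "u' \<in> U v" "u \<noteq> u'"
      "L v u \<union> L v u' \<subseteq> resolving_set G x y"
      using contained[OF xy] by metis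
    have "k \<le> X v u + X v u'" using X(2) p by blast
    also have "\<dots> = sum g (L v u \<union> L v u')"
      using disj[of v u v u'] p finL g_sum by (subst sum.union_disjoint) auto
    also have "\<dots> \<le> sum g (resolving_set G x y)"
      using finG p g_bounds by (intro sum_mono2) (auto simp: resolving_set_def)
    finally show "k \<le> sum g (resolving_set G x y)" .
  qed (use g_bounds in auto)
  have "sum g (verts G) = sum g (\<Union>p\<in>?P. ?Lp p)"
    using finG sub g_off by (intro sum.mono_neutral_right) auto
  also have "\<dots> = (\<Sum>v\<in>I. legs_cost k (U v) (\<lambda>u. card (L v u)))"
    unfolding sum_legs using g_sum X(3) by simp
  finally have total: "(\<Sum>v\<in>I. legs_cost k (U v) (\<lambda>u. card (L v u))) = sum g (verts G)" ..
  \<comment> \<open>The leg weights of any resolving function satisfy the pair constraints, because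
    each pair of legs is itself a resolving set; the weight off the legs is nonnegative.\<close>
  have lower: "(\<Sum>v\<in>I. legs_cost k (U v) (\<lambda>u. card (L v u))) \<le> sum h (verts G)"
    if h: "k_resolving_function G k h" for h
  proof -
    have h_bounds: "0 \<le> h z" "h z \<le> 1" if "z \<in> verts G" for z
      using h that by (auto simp: k_resolving_function_def)
    have "(\<Sum>v\<in>I. legs_cost k (U v) (\<lambda>u. card (L v u))) \<le> (\<Sum>v\<in>I. \<Sum>u\<in>U v. sum h (L v u))"
    proof (intro sum_mono legs_cost_lower)
      fix v u assume p: "v \<in> I" "u \<in> U v"
      have "sum h (L v u) \<le> real (card (L v u)) * 1"
        using L[OF p] h_bounds by (intro sum_bounded_above) auto
      then show "sum h (L v u) \<le> real (card (L v u))" by simp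
    next
      fix v u u' assume p: "v \<in> I" "u \<in> U v" "u' \<in> U v" "u \<noteq> u'"
      obtain x y where xy: "x \<in> verts G" "y \<in> verts G" "x \<noteq> y" "resolving_set G x y = L v u \<union> L v u'"
        using realized[OF p] by blast
      have "k \<le> sum h (resolving_set G x y)"
        using h xy(1-3) by (simp add: k_resolving_function_def)
      then have "k \<le> sum h (L v u \<union> L v u')" unfolding xy(4) .
      then show "k \<le> sum h (L v u) + sum h (L v u')"
        using disj[of v u v u'] p finL by (subst (asm) sum.union_disjoint) auto
    qed (use U in auto)
    also have "\<dots> \<le> sum h (verts G)"
      unfolding sum_legs[symmetric] using finG sub h_bounds by (intro sum_mono2) auto
    finally show ?thesis .
  qed
  \<comment> \<open>\<open>LEAST\<close> on the reals is a minimum only if one is attained;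
    \<open>g\<close> attains the bound \<open>lower\<close>.\<close>
  show ?thesis unfolding frac_metric_dim_def
    using g_resolving total lower by (intro Least_equality) auto
qed

section \<open>The distance of an undirected tree\<close>

text \<open>The set of visited vertices is recorded because a reversed walk will have to avoid a
  given vertex.\<close>

lemma (in sym_digraph) awalk_reverse:
  assumes "awalk u p v"
  shows "\<exists>q. awalk v q u \<and> length q = length p \<and> set (awalk_verts v q) = set (awalk_verts u p)"
  using assms
proof (induction p arbitrary: u)
  case Nil
  then show ?case by (auto simp: awalk_Nil_iff intro!: exI[of _ "[]"])
next
  case (Cons e p)
  then have e: "e \<in> arcs G" "u = tail G e" "awalk (head G e) p v" by (auto simp: awalk_Cons_iff)
  then obtain q where q: "awalk v q (head G e)" "length q = length p"
    "set (awalk_verts v q) = set (awalk_verts (head G e) p)"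
    using Cons.IH by blast
  obtain f where f: "f \<in> arcs G" "tail G f = head G e" "head G f = tail G e"
    using sym_arcs e(1) unfolding symmetric_conv by metis
  have "awalk (head G e) [f] u" using f e arc_implies_awalk[of f] by simp
  then have w: "awalk v (q @ [f]) u" using q by auto
  have "awlast v q = head G e" using q(1) by auto
  then have "set (awalk_verts v (q @ [f])) = insert u (set (awalk_verts v q))"
    using awalk_verts_append[OF w] f e by simp
  then show ?case using w q e by (intro exI[of _ "q @ [f]"]) simp
qed

context wf_digraph
begin

lemma length_awalk_to_apath:
  assumes "awalk u p v"
  shows "length (awalk_to_apath p) \<le> length p"
  using assms
proof (induct rule: awalk_to_apath_induct)
  case (path p)
  then have "awalk_to_apath p = p" by (auto simp: awalk_to_apath.simps)
  then show ?case by simp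
next
  case (decomp p q r s)
  then have "awalk_to_apath p = awalk_to_apath (q @ s)" by (intro step_awalk_to_apath)
  moreover have "p = q @ r @ s" using awalk_cyc_decompE decomp(1-3) by blast
  ultimately show ?case using decomp(4) by simp
qed

text \<open>\<open>graph_dist\<close> minimises over simple paths only, but shortcutting a walk to a
  path never lengthens it.\<close>

lemma graph_dist_le:
  assumes "awalk x p y"
  shows "graph_dist G x y \<le> length p"
proof -
  have "graph_dist G x y \<le> length (awalk_to_apath p)"
    unfolding graph_dist_def using apath_awalk_to_apath[OF assms] by (intro Least_le) blast
  then show ?thesis using length_awalk_to_apath[OF assms] by simp
qed

lemma graph_dist_attained:
  assumes "x \<rightarrow>\<^sup>* y"
  obtains p where "apath x p y" "length p = graph_dist G x y"
proof -
  have "\<exists>n p. apath x p y \<and> length p = n" using assms reachable_apath by blast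
  then have "\<exists>p. apath x p y \<and> length p = graph_dist G x y"
    unfolding graph_dist_def by (rule LeastI_ex)
  then show thesis using that by blast
qed

lemma shortest_awalk_is_apath:
  assumes "awalk x p y" "length p \<le> graph_dist G x y"
  shows "apath x p y"
proof (rule ccontr)
  assume "\<not> apath x p y"
  then obtain q r s w where p: "p = q @ r @ s" "0 < length r" and "awalk x q w" "awalk w s y"
    using assms(1) awalk_not_distinct_decomp[OF assms(1)] unfolding apath_def by blast
  then have "graph_dist G x y \<le> length (q @ s)"
    using graph_dist_le awalk_appendI by blast
  also have "\<dots> < length p" unfolding p(1) using p(2) by (simp only: length_append)
  finally show False using assms(2) by simp
qed

end

locale undirected_tree_graph =
  fixes T :: "('a, 'b) pre_digraph"
  assumes tree: "undirected_tree T"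

sublocale undirected_tree_graph \<subseteq> graph T
  using tree by (simp add: undirected_tree_def)

context undirected_tree_graph
begin

abbreviation dist_T :: "'a \<Rightarrow> 'a \<Rightarrow> nat" where
  "dist_T \<equiv> graph_dist T"

lemma reachable_verts:
  assumes "x \<in> verts T" "y \<in> verts T"
  shows "x \<rightarrow>\<^sup>*\<^bsub>T\<^esub> y"
proof -
  have "strongly_connected (mk_symmetric T)"
    using tree by (simp add: undirected_tree_def Digraph_Component.connected_def)
  then have "x \<rightarrow>\<^sup>*\<^bsub>mk_symmetric T\<^esub> y" using assms by auto
  then show ?thesis using reachable_mk_symmetric_eq sym_arcs by blast
qed

lemma shortest_path:
  assumes "x \<in> verts T" "y \<in> verts T"
  obtains p where "apath x p y" "awalk x p y" "length p = dist_T x y"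
  using graph_dist_attained[OF reachable_verts[OF assms]] awalkI_apath that by metis

lemma dist_self: "x \<in> verts T \<Longrightarrow> dist_T x x = 0"
  using graph_dist_le[of x "[]" x] by (simp add: awalk_Nil_iff)

lemma dist_eq_0:
  assumes "x \<in> verts T" "y \<in> verts T"
  shows "dist_T x y = 0 \<longleftrightarrow> x = y"
proof
  assume "dist_T x y = 0"
  then obtain p where "apath x p y" "length p = 0" using shortest_path[OF assms] by metis
  then show "x = y" by (simp add: apath_Nil_iff)
qed (use assms dist_self in simp)

lemma dist_sym_le:
  assumes "x \<in> verts T" "y \<in> verts T"
  shows "dist_T x y \<le> dist_T y x"
proof -
  obtain p where p: "awalk y p x" "length p = dist_T y x" using shortest_path assms by metis
  then obtain q where "awalk x q y" "length q = length p" using awalk_reverse by blast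
  then show ?thesis using graph_dist_le p by metis
qed

lemma dist_triangle:
  assumes "x \<in> verts T" "y \<in> verts T" "z \<in> verts T"
  shows "dist_T x z \<le> dist_T x y + dist_T y z"
proof -
  obtain p where p: "awalk x p y" "length p = dist_T x y" using shortest_path assms by metis
  obtain q where q: "awalk y q z" "length q = dist_T y z" using shortest_path assms by metis
  have "awalk x (p @ q) z" using awalk_appendI p q by blast
  then have "dist_T x z \<le> length (p @ q)" by (rule graph_dist_le)
  then show ?thesis using p q by simp
qed

lemma dist_arc:
  assumes "e \<in> arcs T"
  shows "dist_T (tail T e) (head T e) = 1"
proof -
  have "dist_T (tail T e) (head T e) \<le> 1" using graph_dist_le[OF arc_implies_awalk[OF assms]] by simp
  moreover have "dist_T (tail T e) (head T e) \<noteq> 0" using dist_eq_0 assms no_loops by simp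
  ultimately show ?thesis by simp
qed

lemma dist_1_arc:
  assumes "x \<in> verts T" "y \<in> verts T" "dist_T x y = 1"
  obtains e where "e \<in> arcs T" "tail T e = x" "head T e = y"
proof -
  obtain p where p: "awalk x p y" "length p = 1" using shortest_path assms by metis
  then obtain e where "p = [e]" by (auto simp: length_Suc_conv)
  then show thesis using that p by (auto simp: awalk_simps)
qed

lemma dist_parent:
  assumes "r \<in> verts T" "y \<in> verts T" "r \<noteq> y"
  shows "\<exists>p\<in>verts T. dist_T y p = 1 \<and> dist_T r y = Suc (dist_T r p)"
proof -
  obtain w where w: "awalk r w y" "length w = dist_T r y" using shortest_path assms by metis
  then have "w \<noteq> []" using assms by (auto simp: awalk_Nil_iff)
  then obtain q e where q: "w = q @ [e]" by (metis rev_exhaust)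
  then have e: "e \<in> arcs T" "head T e = y" "awalk r q (tail T e)"
    using w by (auto simp: awalk_simps)
  have "dist_T y (tail T e) \<le> 1"
    using dist_sym_le[of y "tail T e"] dist_arc[OF e(1)] e assms by simp
  moreover have "dist_T y (tail T e) \<noteq> 0" using dist_eq_0 e assms no_loops by (metis tail_in_verts)
  ultimately have 1: "dist_T y (tail T e) = 1" by simp
  have "dist_T r (tail T e) \<le> length q" using graph_dist_le e by blast
  moreover have "dist_T r y \<le> dist_T r (tail T e) + dist_T (tail T e) y"
    using dist_triangle assms e by simp
  ultimately have "dist_T r y = Suc (dist_T r (tail T e))"
    using dist_arc[OF e(1)] e q w by simp
  then show ?thesis using 1 e by auto
qed

text \<open>Every vertex that a shortest walk meets before its end \<open>x\<close> is strictly
  nearer to \<open>r\<close> than \<open>x\<close>, and \<open>y\<close> is not.\<close>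

lemma closer_walk_avoids:
  assumes "r \<in> verts T" "x \<in> verts T" "y \<in> verts T" "x \<noteq> y" "dist_T r x \<le> dist_T r y"
  obtains w where "awalk r w x" "y \<notin> set (awalk_verts r w)"
proof -
  obtain w where w: "awalk r w x" "length w = dist_T r x" using shortest_path assms by metis
  have "y \<notin> set (awalk_verts r w)"
  proof
    assume "y \<in> set (awalk_verts r w)"
    then obtain q s where qs: "w = q @ s" "awalk r q y" "awalk y s x"
      using awalk_decomp w by blast
    then have "s \<noteq> []" using assms by (auto simp: awalk_Nil_iff)
    then have "length q < length w" using qs by simp
    then show False using graph_dist_le[OF qs(2)] w assms by simp
  qed
  then show thesis using that w by blast
qed

text \<open>Two neighbours of \<open>y\<close> that are no farther from \<open>r\<close> than \<open>y\<close> are joined, through \<open>r\<close>, by a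
  path avoiding \<open>y\<close>, which \<open>y\<close> closes to a cycle.\<close>

lemma dist_parent_unique:
  assumes V: "r \<in> verts T" "y \<in> verts T" "p \<in> verts T" "q \<in> verts T"
    and adj: "dist_T y p = 1" "dist_T y q = 1"
    and le: "dist_T r p \<le> dist_T r y" "dist_T r q \<le> dist_T r y"
  shows "p = q"
proof (rule ccontr)
  assume "p \<noteq> q"
  have "y \<noteq> p" "y \<noteq> q" using adj V dist_self by auto
  obtain w where w: "awalk r w p" "y \<notin> set (awalk_verts r w)"
    using closer_walk_avoids[of r p y] V le \<open>y \<noteq> p\<close> by metis
  obtain w' where w': "awalk r w' q" "y \<notin> set (awalk_verts r w')"
    using closer_walk_avoids[of r q y] V le \<open>y \<noteq> q\<close> by metis
  obtain u where u: "awalk p u r" "y \<notin> set (awalk_verts p u)"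
    using awalk_reverse w by metis
  have uw: "awalk p (u @ w') q" using awalk_appendI u w' by blast
  have "set (awalk_verts p (u @ w')) = set (awalk_verts p u) \<union> set (awalk_verts r w')"
    using set_awalk_verts_append u w' by blast
  then have y: "y \<notin> set (awalk_verts p (u @ w'))" using u w' by simp
  define s where "s = awalk_to_apath (u @ w')"
  have s: "apath p s q" unfolding s_def using apath_awalk_to_apath uw by blast
  \<comment> \<open>Shortcutting only deletes arcs, so the path still avoids
    \<open>y\<close>.\<close>
  have "set s \<subseteq> set (u @ w')" unfolding s_def using awalk_to_apath_subset uw by blast
  then have "y \<notin> set (awalk_verts p s)"
    using y set_awalk_verts[OF uw] set_awalk_verts[OF awalkI_apath[OF s]] by auto
  \<comment> \<open>This makes the closed walk at least three arcs long; a \<open>cycle\<close> of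
    length two, an edge walked back and forth, would contradict nothing.\<close>
  have "s \<noteq> []" using s \<open>p \<noteq> q\<close> by (auto simp: apath_Nil_iff)
  obtain e where e: "e \<in> arcs T" "tail T e = y" "head T e = p" using dist_1_arc V adj by metis
  have "dist_T q y \<le> 1" using dist_sym_le V adj by metis
  moreover have "dist_T q y \<noteq> 0" using dist_eq_0 V \<open>y \<noteq> q\<close> by blast
  ultimately have "dist_T q y = 1" by simp
  then obtain f where f: "f \<in> arcs T" "tail T f = q" "head T f = y" using dist_1_arc V by metis
  have fw: "awalk q [f] y" using f arc_implies_awalk[of f] by simp
  have sf: "awalk p (s @ [f]) y" using awalk_appendI[OF awalkI_apath[OF s] fw] .
  have "awlast p s = q" using awalkI_apath[OF s] by auto
  then have "awalk_verts p (s @ [f]) = awalk_verts p s @ [y]"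
    using awalk_verts_append[OF sf] f by simp
  then have "distinct (tl (awalk_verts y (e # s @ [f])))"
    using e s \<open>y \<notin> set (awalk_verts p s)\<close> by (simp add: apath_def)
  moreover have "awalk y (e # s @ [f]) y" using e sf by (simp add: awalk_Cons_iff del: awalk_append_iff)
  ultimately have "cycle (e # s @ [f])" unfolding cycle_def by blast
  moreover have "3 \<le> length (e # s @ [f])" using \<open>s \<noteq> []\<close> by (cases s) auto
  ultimately show False using tree by (auto simp: undirected_tree_def)
qed

sublocale M: metric_tree "verts T" dist_T
proof
  show "dist_T x y = dist_T y x" if "x \<in> verts T" "y \<in> verts T" for x y
    using dist_sym_le that by (simp add: order_antisym)
qed (use dist_eq_0 dist_triangle dist_parent dist_parent_unique in auto)

section \<open>Translation of the graph notions into metric ones\<close>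

lemma out_degree_eq:
  assumes "v \<in> verts T"
  shows "out_degree T v = card (M.nbrs v)"
proof -
  have "bij_betw (head T) (out_arcs T v) (M.nbrs v)"
  proof (rule bij_betwI')
    fix e f assume "e \<in> out_arcs T v" "f \<in> out_arcs T v"
    then show "(head T e = head T f) = (e = f)"
      using no_multi_arcs[of e f] by (auto simp: arc_to_ends_def)
  next
    fix e assume "e \<in> out_arcs T v"
    then show "head T e \<in> M.nbrs v" using dist_arc[of e] by (auto simp: M.nbrs_def)
  next
    fix p assume "p \<in> M.nbrs v"
    then have "p \<in> verts T" "dist_T v p = 1" by (simp_all add: M.nbrs_def)
    then obtain e where "e \<in> arcs T" "tail T e = v" "head T e = p"
      using dist_1_arc[OF assms] by blast
    then show "\<exists>e\<in>out_arcs T v. p = head T e" by auto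
  qed
  then show ?thesis unfolding out_degree_def by (rule bij_betw_same_card)
qed

lemma is_major_iff: "is_major T v \<longleftrightarrow> M.major v"
  using out_degree_eq by (auto simp: is_major_def M.major_def)

lemma terminal_vertices_eq: "terminal_vertices T v = M.terminals v"
  using out_degree_eq by (auto simp: terminal_vertices_def M.terminals_def is_leaf_def is_major_iff)

lemma resolving_set_eq: "resolving_set T x y = M.resolving x y"
  by (simp add: resolving_set_def M.resolving_def)

lemma exterior_major_star_eq: "exterior_major_star T = M.star_majors"
  by (auto simp: exterior_major_star_def exterior_major2_def exterior_major3_def
      exterior_major_def terminal_degree_def terminal_vertices_eq is_major_iff M.star_majors_def)

text \<open>If the first step led away from \<open>y\<close>, the rest, shortest by induction, would
  next move to a vertex nearer to \<open>y\<close>. By \<open>parent_unique\<close> that vertex is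
  \<open>x\<close>, which a simple path cannot revisit. Thus the paths defining
  \<open>T\<^sub>v\<close> are metric intervals.\<close>

lemma apath_length:
  assumes "apath x p y"
  shows "length p = dist_T x y"
  using assms
proof (induction p arbitrary: x)
  case Nil
  then show ?case by (auto simp: apath_Nil_iff dist_self)
next
  case (Cons e p)
  define x' where "x' = head T e"
  have e: "e \<in> arcs T" "tail T e = x" "apath x' p y" "x \<notin> set (awalk_verts x' p)"
    using Cons.prems by (auto simp: apath_Cons_iff x'_def)
  have V: "x \<in> verts T" "x' \<in> verts T" "y \<in> verts T"
    using e awalk_last_in_verts[OF awalkI_apath[OF e(3)]] by (auto simp: x'_def)
  have IH: "length p = dist_T x' y" using Cons.IH e by (simp add: x'_def)
  have 1: "dist_T x x' = 1" using dist_arc[OF e(1)] e by (simp add: x'_def)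
  have adj: "dist_T x' x = 1" using 1 M.dist_sym V by simp
  have "dist_T x y = Suc (dist_T x' y)"
  proof (rule ccontr)
    assume "dist_T x y \<noteq> Suc (dist_T x' y)"
    then have x: "dist_T x' y = Suc (dist_T x y)"
      using M.dist_nbr_cases[of x x' y] V 1 by (auto simp: M.nbrs_def)
    then have "p \<noteq> []" using IH by auto
    then obtain f s where fs: "p = f # s" by (cases p) auto
    have f: "f \<in> arcs T" "tail T f = x'" "apath (head T f) s y"
      using e(3) fs by (auto simp: apath_Cons_iff)
    have "dist_T (head T f) y \<le> length s" using graph_dist_le awalkI_apath f(3) by blast
    then have "dist_T (head T f) y \<le> dist_T x' y" using IH fs by simp
    then have "x = head T f"
      using M.parent_unique[of y x' x "head T f"] V adj x f dist_arc[OF f(1)]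
        M.dist_sym[of y x] M.dist_sym[of y x'] M.dist_sym[of y "head T f"] by simp
    moreover have "head T f \<in> set (awalk_verts x' p)"
      using fs hd_in_awalk_verts(2)[OF f(3)] by simp
    ultimately show False using e(4) by simp
  qed
  then show ?case using IH by simp
qed

lemma apath_verts_between:
  assumes p: "apath x p y" and z: "z \<in> set (awalk_verts x p)"
  shows "z \<in> verts T" "dist_T x z + dist_T z y = dist_T x y"
proof -
  obtain q s where qs: "p = q @ s" "awalk x q z" "awalk z s y"
    using awalk_decomp awalkI_apath[OF p] z by blast
  show zV: "z \<in> verts T" using qs by auto
  have V: "x \<in> verts T" "y \<in> verts T"
    using awalk_hd_in_verts[OF qs(2)] awalk_last_in_verts[OF qs(3)] by auto
  have "dist_T x y = length q + length s" using apath_length[OF p] qs by simp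
  then show "dist_T x z + dist_T z y = dist_T x y"
    using graph_dist_le[OF qs(2)] graph_dist_le[OF qs(3)] dist_triangle[OF V(1) zV V(2)] by simp
qed

lemma between_on_apath:
  assumes V: "x \<in> verts T" "y \<in> verts T" "z \<in> verts T"
    and z: "dist_T x z + dist_T z y = dist_T x y"
  obtains p where "apath x p y" "z \<in> set (awalk_verts x p)"
proof -
  obtain q where q: "awalk x q z" "length q = dist_T x z" using shortest_path V by metis
  obtain s where s: "awalk z s y" "length s = dist_T z y" using shortest_path V by metis
  have "awalk x (q @ s) y" using awalk_appendI q s by blast
  then have "apath x (q @ s) y" using shortest_awalk_is_apath q s z by simp
  moreover have "set (awalk_verts x (q @ s)) = set (awalk_verts x q) \<union> set (awalk_verts z s)"
    using set_awalk_verts_append q s by blast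
  moreover have "z \<in> set (awalk_verts z s)" using hd_in_awalk_verts s by blast
  ultimately show thesis using that by blast
qed

lemma branch_subtree_eq:
  assumes "M.major v"
  shows "branch_subtree T v = T \<restriction> M.spider v"
proof -
  have v: "v \<in> verts T" using assms M.majorD by blast
  have "insert v {x. \<exists>u p. u \<in> terminal_vertices T v \<and> apath v p u \<and> x \<in> set (awalk_verts v p)}
      = M.spider v" (is "insert v ?X = _")
  proof (intro equalityI subsetI)
    fix x assume x: "x \<in> insert v ?X"
    show "x \<in> M.spider v"
    proof (cases "x = v")
      case False
      then obtain u p where u: "u \<in> M.terminals v" "apath v p u" "x \<in> set (awalk_verts v p)"
        using x by (auto simp: terminal_vertices_eq)
      then have "x \<in> M.leg v u"
        using apath_verts_between[OF u(2,3)] False by (simp add: M.leg_def)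
      then show ?thesis using u(1) by (auto simp: M.spider_def)
    qed (simp add: M.spider_def)
  next
    fix x assume x: "x \<in> M.spider v"
    show "x \<in> insert v ?X"
    proof (cases "x = v")
      case False
      then obtain u where u: "u \<in> M.terminals v" "x \<in> M.leg v u" using x by (auto simp: M.spider_def)
      then have "u \<in> verts T" by (simp add: M.terminals_def)
      then obtain p where "apath v p u" "x \<in> set (awalk_verts v p)"
        using between_on_apath[of v u x] u v by (auto simp: M.leg_def)
      then show ?thesis using u by (auto simp: terminal_vertices_eq)
    qed simp
  qed
  then show ?thesis by (simp add: branch_subtree_def)
qed

text \<open>A shortest path of \<open>T\<close> stays inside \<open>S\<close> and survives in the
  induced subgraph. Conversely, a path there is a path of \<open>T\<close>, and by
  \<open>apath_length\<close> all of these have the same length.\<close>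

lemma graph_dist_convex:
  assumes S: "S \<subseteq> verts T" "x \<in> S" "y \<in> S"
    and convex: "\<And>z. z \<in> verts T \<Longrightarrow> dist_T x z + dist_T z y = dist_T x y \<Longrightarrow> z \<in> S"
  shows "graph_dist (T \<restriction> S) x y = dist_T x y"
proof -
  have wf: "wf_digraph (T \<restriction> S)" by (rule wellformed_induce_subgraph)
  have sub: "subgraph (T \<restriction> S) T"
    using S wf wf_digraph by (auto simp: subgraph_def compatible_def)
  have compat: "compatible T (T \<restriction> S)" by (simp add: compatible_def)
  obtain p where p: "apath x p y" "length p = dist_T x y" using shortest_path S by blast
  have "set (awalk_verts x p) \<subseteq> S" using apath_verts_between[OF p(1)] convex by blast
  then have "tail T e \<in> S \<and> head T e \<in> S" if "e \<in> set p" for e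
    using set_awalk_verts[OF awalkI_apath[OF p(1)]] that by auto
  then have "pre_digraph.apath (T \<restriction> S) x p y"
    using p(1) S(2) unfolding pre_digraph.apath_def pre_digraph.awalk_def
    by (auto simp: compatible_cas[OF compat] compatible_awalk_verts[OF compat])
  moreover have "length q = dist_T x y" if "pre_digraph.apath (T \<restriction> S) x q y" for q
    using subgraph_apath_imp_apath[OF that sub] apath_length by blast
  ultimately show ?thesis unfolding graph_dist_def[of "T \<restriction> S"]
    using p(2) by (intro Least_equality) auto
qed

lemma spider_subset: "M.major v \<Longrightarrow> M.spider v \<subseteq> verts T"
  using M.majorD by (auto simp: M.spider_def M.leg_def)

lemma resolving_set_branch_subtree:
  assumes v: "M.major v" and xy: "x \<in> M.spider v" "y \<in> M.spider v"
  shows "resolving_set (branch_subtree T v) x y = M.resolving x y \<inter> M.spider v"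
proof -
  have "graph_dist (T \<restriction> M.spider v) a b = dist_T a b"
    if "a \<in> M.spider v" "b \<in> M.spider v" for a b
    using graph_dist_convex[OF spider_subset[OF v] that] M.spider_convex[OF v that] by blast
  then show ?thesis using xy spider_subset[OF v]
    by (auto simp: resolving_set_def M.resolving_def branch_subtree_eq[OF v])
qed

end

section \<open>Decomposition over the exterior major vertices\<close>

context undirected_tree_graph
begin

text \<open>For a major \<open>v\<close> these are the cardinalities of unions of two legs, since
  the legs are disjoint.\<close>

definition leg_pair_sizes :: "'a \<Rightarrow> nat set" where
  "leg_pair_sizes v = {card (M.leg v u) + card (M.leg v u') | u u'.
     u \<in> M.terminals v \<and> u' \<in> M.terminals v \<and> u \<noteq> u'}"

lemma star_majorsD:
  "v \<in> M.star_majors \<Longrightarrow> M.major v"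
  "v \<in> M.star_majors \<Longrightarrow> 2 \<le> card (M.terminals v)"
  by (simp_all add: M.star_majors_def)

lemma finite_leg [simp]: "finite (M.leg v u)"
  using finite_subset[OF M.leg_subset] by simp

lemma card_two_legs:
  assumes "M.major v" "u \<in> M.terminals v" "u' \<in> M.terminals v" "u \<noteq> u'"
  shows "card (M.leg v u \<union> M.leg v u') = card (M.leg v u) + card (M.leg v u')"
  using M.legs_disjoint_same[OF assms] by (simp add: card_Un_disjoint)

lemma finite_leg_pair_sizes: "finite (leg_pair_sizes v)"
proof -
  have "leg_pair_sizes v \<subseteq> (\<lambda>(u, u'). card (M.leg v u) + card (M.leg v u')) `
      (M.terminals v \<times> M.terminals v)"
    by (auto simp: leg_pair_sizes_def)
  then show ?thesis by (rule finite_subset) simp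
qed

lemma leg_pair_sizes_nonempty:
  assumes "2 \<le> card (M.terminals v)"
  shows "leg_pair_sizes v \<noteq> {}"
proof -
  obtain u u' where "u \<in> M.terminals v" "u' \<in> M.terminals v" "u \<noteq> u'"
    using obtain_two[OF assms] .
  then show ?thesis by (auto simp: leg_pair_sizes_def)
qed

lemma finite_star_majors: "finite M.star_majors"
  by (rule finite_subset[of _ "verts T"]) (auto simp: M.star_majors_def M.major_def)

lemma star_majors_nonempty:
  assumes "M.major x"
  shows "M.star_majors \<noteq> {}"
proof -
  obtain v u u' where "M.major v" "u \<in> M.terminals v" "u' \<in> M.terminals v" "u \<noteq> u'"
    using M.two_legs_exist[OF assms] .
  then have "v \<in> M.star_majors" by (rule M.star_majorsI)
  then show ?thesis by auto
qed

section \<open>Kappa of \<open>T\<close> and of \<open>T\<^sub>v\<close>\<close>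

lemma metric_kappa_tree:
  assumes "M.major x"
  shows "metric_kappa T = Min (\<Union>v\<in>M.star_majors. leg_pair_sizes v)"
proof (rule metric_kappa_eqI)
  show "finite (\<Union>v\<in>M.star_majors. leg_pair_sizes v)"
    using finite_star_majors finite_leg_pair_sizes by blast
  show "(\<Union>v\<in>M.star_majors. leg_pair_sizes v) \<noteq> {}"
    using star_majors_nonempty[OF assms] leg_pair_sizes_nonempty star_majorsD(2) by blast
next
  fix n assume "n \<in> (\<Union>v\<in>M.star_majors. leg_pair_sizes v)"
  then obtain v u u' where v: "M.major v" and u: "u \<in> M.terminals v" "u' \<in> M.terminals v" "u \<noteq> u'"
    and n: "n = card (M.leg v u) + card (M.leg v u')"
    using star_majorsD(1) by (auto simp: leg_pair_sizes_def)
  obtain y z where yz: "y \<in> M.leg v u" "z \<in> M.leg v u'" "y \<noteq> z"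
    "M.resolving y z = M.leg v u \<union> M.leg v u'"
    using M.resolving_two_legs[OF v u] .
  then have "card (resolving_set T y z) = n"
    using card_two_legs[OF v u] n by (simp add: resolving_set_eq)
  then show "\<exists>y\<in>verts T. \<exists>z\<in>verts T. y \<noteq> z \<and> card (resolving_set T y z) = n"
    using yz M.leg_subset by blast
next
  fix y z assume yz: "y \<in> verts T" "z \<in> verts T" "y \<noteq> z"
  obtain v u u' where v: "v \<in> M.star_majors" and u: "u \<in> M.terminals v" "u' \<in> M.terminals v" "u \<noteq> u'"
    and sub: "M.leg v u \<union> M.leg v u' \<subseteq> M.resolving y z"
    using M.two_legs_in_resolving[OF yz exI[of M.major, OF assms]] .
  have "finite (M.resolving y z)" by (simp add: M.resolving_def)
  then have "card (M.leg v u) + card (M.leg v u') \<le> card (resolving_set T y z)"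
    unfolding resolving_set_eq card_two_legs[OF star_majorsD(1)[OF v] u, symmetric]
    using sub by (rule card_mono)
  moreover have "card (M.leg v u) + card (M.leg v u') \<in> leg_pair_sizes v"
    using u by (auto simp: leg_pair_sizes_def)
  ultimately show "\<exists>n\<in>\<Union>v\<in>M.star_majors. leg_pair_sizes v. n \<le> card (resolving_set T y z)"
    using v by blast
qed simp

lemma leg_subset_spider: "u \<in> M.terminals v \<Longrightarrow> M.leg v u \<subseteq> M.spider v"
  by (auto simp: M.spider_def)

lemma verts_branch_subtree: "M.major v \<Longrightarrow> verts (branch_subtree T v) = M.spider v"
  by (simp add: branch_subtree_eq)

lemma finite_spider: "M.major v \<Longrightarrow> finite (M.spider v)"
  using finite_subset[OF spider_subset] by simp

lemma branch_subtree_resolving_two_legs: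
  assumes v: "M.major v" and u: "u \<in> M.terminals v" "u' \<in> M.terminals v" "u \<noteq> u'"
  shows "\<exists>x\<in>M.spider v. \<exists>y\<in>M.spider v. x \<noteq> y \<and>
    resolving_set (branch_subtree T v) x y = M.leg v u \<union> M.leg v u'"
proof -
  obtain x y where xy: "x \<in> M.leg v u" "y \<in> M.leg v u'" "x \<noteq> y"
    "M.resolving x y = M.leg v u \<union> M.leg v u'"
    using M.resolving_two_legs[OF v u] .
  have in_spider: "x \<in> M.spider v" "y \<in> M.spider v" using xy u leg_subset_spider by blast+
  have "resolving_set (branch_subtree T v) x y = M.leg v u \<union> M.leg v u'"
    using resolving_set_branch_subtree[OF v in_spider] xy(4) u leg_subset_spider by blast
  then show ?thesis using in_spider xy(3) by blast
qed

lemma metric_kappa_branch_subtree: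
  assumes v: "M.major v" "2 \<le> card (M.terminals v)"
  shows "metric_kappa (branch_subtree T v) = Min (leg_pair_sizes v)"
proof (rule metric_kappa_eqI)
  show "finite (verts (branch_subtree T v))"
    using finite_spider[OF v(1)] verts_branch_subtree[OF v(1)] by simp
  show "finite (leg_pair_sizes v)" "leg_pair_sizes v \<noteq> {}"
    using finite_leg_pair_sizes leg_pair_sizes_nonempty[OF v(2)] by auto
next
  fix n assume "n \<in> leg_pair_sizes v"
  then obtain u u' where u: "u \<in> M.terminals v" "u' \<in> M.terminals v" "u \<noteq> u'"
    and n: "n = card (M.leg v u) + card (M.leg v u')"
    by (auto simp: leg_pair_sizes_def)
  then show "\<exists>x\<in>verts (branch_subtree T v). \<exists>y\<in>verts (branch_subtree T v).
      x \<noteq> y \<and> card (resolving_set (branch_subtree T v) x y) = n"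
    using branch_subtree_resolving_two_legs[OF v(1) u] card_two_legs[OF v(1) u]
    unfolding verts_branch_subtree[OF v(1)] n by metis
next
  fix x y assume "x \<in> verts (branch_subtree T v)" "y \<in> verts (branch_subtree T v)" "x \<noteq> y"
  then have xy: "x \<in> M.spider v" "y \<in> M.spider v" "x \<noteq> y"
    using verts_branch_subtree[OF v(1)] by auto
  let ?R = "resolving_set (branch_subtree T v) x y"
  have R: "?R = M.resolving x y \<inter> M.spider v"
    by (rule resolving_set_branch_subtree[OF v(1) xy(1,2)])
  have finR: "finite ?R" unfolding R using finite_spider[OF v(1)] by blast
  have pair: "\<exists>n\<in>leg_pair_sizes v. n \<le> card ?R"
    if u: "u \<in> M.terminals v" "u' \<in> M.terminals v" "u \<noteq> u'"
      and le: "card (M.leg v u \<union> M.leg v u') \<le> card ?R" for u u'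
    using u le card_two_legs[OF v(1) u] by (auto simp: leg_pair_sizes_def)
  show "\<exists>n\<in>leg_pair_sizes v. n \<le> card ?R"
    using v xy
  proof (cases rule: M.spider_resolving)
    case (legs u u')
    have "M.leg v u \<union> M.leg v u' \<subseteq> ?R" unfolding R using legs leg_subset_spider by blast
    then show ?thesis using pair[OF legs(1-3)] card_mono[OF finR] by blast
  next
    case (point w t)
    obtain u u' where u: "u \<in> M.terminals v" "u' \<in> M.terminals v" "u \<noteq> u'"
      using obtain_two[OF v(2)] .
    have w: "w \<in> M.spider v" using point leg_subset_spider by blast
    \<comment> \<open>The resolving set misses \<open>w\<close> and need not contain two legs. Only
      sizes are compared: the centre \<open>v\<close>, which lies in no leg, makes up for the loss
      of \<open>w\<close>.\<close>
    have "v \<notin> M.leg v u \<union> M.leg v u'" by (simp add: M.leg_def)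
    then have "Suc (card (M.leg v u \<union> M.leg v u')) = card (insert v (M.leg v u \<union> M.leg v u'))"
      by simp
    also have "\<dots> \<le> card (M.spider v)"
      using u leg_subset_spider finite_spider[OF v(1)]
      by (intro card_mono) (auto simp: M.spider_def)
    also have "\<dots> = Suc (card (M.spider v - {w}))"
      by (rule card.remove[OF finite_spider[OF v(1)] w])
    also have "M.spider v - {w} = ?R" unfolding R point(3) using spider_subset[OF v(1)] by blast
    finally show ?thesis using pair[OF u] by simp
  qed
qed

section \<open>The fractional dimension of \<open>T\<close> and of \<open>T\<^sub>v\<close>\<close>

lemma frac_metric_dim_tree:
  assumes x: "M.major x" and k: "0 \<le> k" "k \<le> real (metric_kappa T)"
  shows "frac_metric_dim k T =
    (\<Sum>v\<in>M.star_majors. legs_cost k (M.terminals v) (\<lambda>u. card (M.leg v u)))"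
proof (rule frac_metric_dim_legs)
  show "M.leg v u \<inter> M.leg v' u' = {}"
    if "v \<in> M.star_majors" "u \<in> M.terminals v" "v' \<in> M.star_majors" "u' \<in> M.terminals v'"
      "(v, u) \<noteq> (v', u')" for v u v' u'
    using M.legs_disjoint_same[of v u u'] M.legs_disjoint_other[of v u v' u'] that star_majorsD(1)
    by (cases "v = v'") auto
  show "M.leg v u \<subseteq> verts T \<and> M.leg v u \<noteq> {}"
    if "v \<in> M.star_majors" "u \<in> M.terminals v" for v u
    using M.leg_is_branch[OF star_majorsD(1)[OF that(1)] that(2)] M.leg_subset by blast
  show "\<exists>y\<in>verts T. \<exists>z\<in>verts T. y \<noteq> z \<and> resolving_set T y z = M.leg v u \<union> M.leg v u'"
    if v: "v \<in> M.star_majors" and u: "u \<in> M.terminals v" "u' \<in> M.terminals v" "u \<noteq> u'" for v u u'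
  proof -
    obtain y z where "y \<in> M.leg v u" "z \<in> M.leg v u'" "y \<noteq> z"
      "M.resolving y z = M.leg v u \<union> M.leg v u'"
      using M.resolving_two_legs[OF star_majorsD(1)[OF v] u] .
    then show ?thesis unfolding resolving_set_eq using M.leg_subset by blast
  qed
  show "\<exists>v\<in>M.star_majors. \<exists>u\<in>M.terminals v. \<exists>u'\<in>M.terminals v. u \<noteq> u' \<and>
      M.leg v u \<union> M.leg v u' \<subseteq> resolving_set T y z"
    if yz: "y \<in> verts T" "z \<in> verts T" "y \<noteq> z" for y z
  proof -
    obtain v u u' where "v \<in> M.star_majors" "u \<in> M.terminals v" "u' \<in> M.terminals v" "u \<noteq> u'"
      "M.leg v u \<union> M.leg v u' \<subseteq> M.resolving y z"
      using M.two_legs_in_resolving[OF yz exI[of M.major, OF x]] .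
    then show ?thesis unfolding resolving_set_eq by metis
  qed
  show "k \<le> real (card (M.leg v u)) + real (card (M.leg v u'))"
    if v: "v \<in> M.star_majors" and u: "u \<in> M.terminals v" "u' \<in> M.terminals v" "u \<noteq> u'" for v u u'
  proof -
    \<comment> \<open>Two legs at \<open>v\<close> form a resolving set, so together they have at
      least kappa vertices; this is how the upper bound on \<open>k\<close> yields
      feasibility.\<close>
    have "card (M.leg v u) + card (M.leg v u') \<in> (\<Union>v\<in>M.star_majors. leg_pair_sizes v)"
      using v u by (auto simp: leg_pair_sizes_def)
    moreover have "finite (\<Union>v\<in>M.star_majors. leg_pair_sizes v)"
      using finite_star_majors finite_leg_pair_sizes by blast
    ultimately have "metric_kappa T \<le> card (M.leg v u) + card (M.leg v u')"
      unfolding metric_kappa_tree[OF x] by (intro Min_le)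
    then show ?thesis using k(2) by linarith
  qed
qed (use finite_star_majors star_majorsD(2) k(1) in auto)

lemma frac_metric_dim_branch_subtree:
  assumes v: "M.major v" "3 \<le> card (M.terminals v)"
    and k: "0 \<le> k" "k \<le> real (metric_kappa (branch_subtree T v))"
  shows "frac_metric_dim k (branch_subtree T v) =
    legs_cost k (M.terminals v) (\<lambda>u. card (M.leg v u))"
proof -
  have two: "2 \<le> card (M.terminals v)" using v(2) by simp
  note V = verts_branch_subtree[OF v(1)]
  have "frac_metric_dim k (branch_subtree T v) =
      (\<Sum>w\<in>{v}. legs_cost k (M.terminals w) (\<lambda>u. card (M.leg w u)))"
  proof (rule frac_metric_dim_legs)
    show "finite (verts (branch_subtree T v))" using V finite_spider[OF v(1)] by simp
    show "M.leg w u \<subseteq> verts (branch_subtree T v) \<and> M.leg w u \<noteq> {}"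
      if "w \<in> {v}" "u \<in> M.terminals w" for w u
      using M.leg_is_branch[OF v(1), of u] leg_subset_spider[of u v] that V by auto
    show "M.leg w u \<inter> M.leg w' u' = {}"
      if "w \<in> {v}" "u \<in> M.terminals w" "w' \<in> {v}" "u' \<in> M.terminals w'" "(w, u) \<noteq> (w', u')"
      for w u w' u'
      using M.legs_disjoint_same[OF v(1), of u u'] that by auto
    show "\<exists>x\<in>verts (branch_subtree T v). \<exists>y\<in>verts (branch_subtree T v). x \<noteq> y \<and>
        resolving_set (branch_subtree T v) x y = M.leg w u \<union> M.leg w u'"
      if "w \<in> {v}" "u \<in> M.terminals w" "u' \<in> M.terminals w" "u \<noteq> u'" for w u u'
      using branch_subtree_resolving_two_legs[OF v(1), of u u'] that V by simp
    show "\<exists>w\<in>{v}. \<exists>u\<in>M.terminals w. \<exists>u'\<in>M.terminals w. u \<noteq> u' \<and>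
        M.leg w u \<union> M.leg w u' \<subseteq> resolving_set (branch_subtree T v) x y"
      if "x \<in> verts (branch_subtree T v)" "y \<in> verts (branch_subtree T v)" "x \<noteq> y" for x y
    proof -
      have xy: "x \<in> M.spider v" "y \<in> M.spider v" "x \<noteq> y" using that V by auto
      have R: "resolving_set (branch_subtree T v) x y = M.resolving x y \<inter> M.spider v"
        by (rule resolving_set_branch_subtree[OF v(1) xy(1,2)])
      have "\<exists>u\<in>M.terminals v. \<exists>u'\<in>M.terminals v. u \<noteq> u' \<and>
          M.leg v u \<union> M.leg v u' \<subseteq> M.resolving x y"
        using v(1) two xy
      proof (cases rule: M.spider_resolving)
        case (legs u u')
        then show ?thesis by metis
      next
        case (point w t)
        \<comment> \<open>The leg of \<open>t\<close>, which holds the unresolved vertex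
          \<open>w\<close>, is discarded; terminal degree at least three leaves two complete
          legs.\<close>
        have "2 \<le> card (M.terminals v - {t})" using v(2) point(1) by simp
        then obtain u u' where u: "u \<in> M.terminals v - {t}" "u' \<in> M.terminals v - {t}" "u \<noteq> u'"
          using obtain_two by metis
        then have "w \<notin> M.leg v u" "w \<notin> M.leg v u'"
          using M.legs_disjoint_same[OF v(1) point(1)] point(2) by blast+
        then have "M.leg v u \<union> M.leg v u' \<subseteq> M.resolving x y"
          unfolding point(3) using M.leg_subset by blast
        then show ?thesis using u by (metis DiffD1)
      qed
      then show ?thesis unfolding R using leg_subset_spider by (metis Int_greatest Un_least singletonI)
    qed
    show "k \<le> real (card (M.leg w u)) + real (card (M.leg w u'))"
      if "w \<in> {v}" "u \<in> M.terminals w" "u' \<in> M.terminals w" "u \<noteq> u'" for w u u'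
    proof -
      have "card (M.leg v u) + card (M.leg v u') \<in> leg_pair_sizes v"
        using that by (auto simp: leg_pair_sizes_def)
      then have "metric_kappa (branch_subtree T v) \<le> card (M.leg v u) + card (M.leg v u')"
        unfolding metric_kappa_branch_subtree[OF v(1) two]
        using finite_leg_pair_sizes by (intro Min_le)
      then show ?thesis using k(2) that(1) by simp
    qed
  qed (use two k(1) in auto)
  then show ?thesis by simp
qed

end

theorem theorem4p5:
  fixes T :: "('a, 'b) pre_digraph"
  assumes "undirected_tree T"
    and "1 \<le> exterior_major_count T"
  shows "metric_kappa T = Min ((\<lambda>v. metric_kappa (branch_subtree T v)) ` exterior_major_star T) \<and>
    (\<forall>k::real. 1 \<le> k \<and> k \<le> real (metric_kappa T) \<longrightarrow>
       frac_metric_dim k T =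
         k * real (card (exterior_major2 T)) +
         (\<Sum>v \<in> exterior_major3 T. frac_metric_dim k (branch_subtree T v)))"
proof -
  interpret undirected_tree_graph T by unfold_locales (rule assms(1))
  have "exterior_major T \<noteq> {}" using assms(2) by (auto simp: exterior_major_count_def)
  then obtain x where x: "M.major x" by (auto simp: exterior_major_def is_major_iff)
  let ?I = "M.star_majors"
  have sizes: "finite (leg_pair_sizes v) \<and> leg_pair_sizes v \<noteq> {}" if "v \<in> ?I" for v
    using finite_leg_pair_sizes leg_pair_sizes_nonempty star_majorsD(2)[OF that] by blast
  have kappa_v: "metric_kappa (branch_subtree T v) = Min (leg_pair_sizes v)" if "v \<in> ?I" for v
    using metric_kappa_branch_subtree star_majorsD[OF that] .
  have "metric_kappa T = Min ((\<lambda>v. Min (leg_pair_sizes v)) ` ?I)"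
    unfolding metric_kappa_tree[OF x]
    using finite_star_majors star_majors_nonempty[OF x] sizes by (rule Min_Union)
  also have "(\<lambda>v. Min (leg_pair_sizes v)) ` ?I = (\<lambda>v. metric_kappa (branch_subtree T v)) ` ?I"
    using kappa_v by (intro image_cong) auto
  finally have kappa: "metric_kappa T = Min ((\<lambda>v. metric_kappa (branch_subtree T v)) ` ?I)" .
  have major3: "M.major v" "3 \<le> card (M.terminals v)" "v \<in> ?I" if "v \<in> exterior_major3 T" for v
    using that by (auto simp: exterior_major3_def exterior_major_def terminal_degree_def
        terminal_vertices_eq is_major_iff M.star_majors_def)
  have "frac_metric_dim k T = k * real (card (exterior_major2 T)) +
      (\<Sum>v\<in>exterior_major3 T. frac_metric_dim k (branch_subtree T v))"
    if k: "1 \<le> k" "k \<le> real (metric_kappa T)" for k :: real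
  proof -
    let ?c = "\<lambda>v. legs_cost k (M.terminals v) (\<lambda>u. card (M.leg v u))"
    have parts: "?I = exterior_major2 T \<union> exterior_major3 T"
      using exterior_major_star_eq by (simp add: exterior_major_star_def)
    have fin: "finite (exterior_major2 T)" "finite (exterior_major3 T)"
      using finite_star_majors unfolding parts by simp_all
    have "frac_metric_dim k T = sum ?c ?I" using frac_metric_dim_tree[OF x] k by simp
    also have "\<dots> = sum ?c (exterior_major2 T) + sum ?c (exterior_major3 T)"
      unfolding parts using fin
      by (intro sum.union_disjoint) (auto simp: exterior_major2_def exterior_major3_def)
    also have "sum ?c (exterior_major2 T) = (\<Sum>v\<in>exterior_major2 T. k)"
      by (intro sum.cong refl legs_cost_two)
        (simp add: exterior_major2_def terminal_degree_def terminal_vertices_eq)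
    also have "\<dots> = k * real (card (exterior_major2 T))" by simp
    also have "sum ?c (exterior_major3 T) =
        (\<Sum>v\<in>exterior_major3 T. frac_metric_dim k (branch_subtree T v))"
    proof (intro sum.cong refl)
      fix v assume v: "v \<in> exterior_major3 T"
      \<comment> \<open>As kappa(\<open>T\<close>) is the minimum over \<open>M\<^sup>*\<close>, an
        admissible \<open>k\<close> for \<open>T\<close> is admissible for every
        \<open>T\<^sub>v\<close>.\<close>
      have "metric_kappa T \<le> metric_kappa (branch_subtree T v)"
        unfolding kappa using major3(3)[OF v] finite_star_majors by (intro Min_le) auto
      then have "k \<le> real (metric_kappa (branch_subtree T v))" using k(2) by linarith
      then show "?c v = frac_metric_dim k (branch_subtree T v)"
        using frac_metric_dim_branch_subtree[OF major3(1,2)[OF v]] k(1) by simp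
    qed
    finally show ?thesis .
  qed
  then show ?thesis using kappa unfolding exterior_major_star_eq by blast
qed

end
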